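(* Let $n\ge2$, $1\le k \le n-1$, $\rho=(k-1)/2$, $\sigma=(n-k)/2-1$, and let $\{Y^n_{j,\lambda}\}$ ($j=0,1,2,\dots$; $\lambda=1,\dots,d_n(j)$) be an orthonormal basis of (real) spherical harmonics in $L^2(S^n)$, $Y^n_{j,\lambda}$ having degree $j$. Let $j\in \{0,2,4,\ldots \}$, $\alpha_j=\varkappa_j \sqrt {d_n(j)}$, and $$\hat Y_{j, \lambda} (v) = \alpha_j \int_{S^n} Y^n_{j, \lambda} (x)\, R_{j/2}^{(\rho, \sigma )}(2|x^T v|^2 - 1)\, d_*x,\qquad v\in V_{n+1,n-k}.$$ Then the following addition formula holds for $x\in S^n$ and $v\in V_{n+1,n-k}$: $$R^{(\rho,\sigma)}_{j/2} (2|x^T v|^2-1) = \alpha_j^{-1} \sum^{d_n(j)}_{\lambda = 1} Y^n_{j, \lambda} (x)\, \hat Y_{j, \lambda} (v).$$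
   Context: $S^n\subset\mathbb{R}^{n+1}$ is the unit sphere, $d_*x$ its normalized (probability) surface measure; orthonormality in $L^2(S^n)$ is with respect to $d_*x$. $\sigma_m=2\pi^{(m+1)/2}/\Gamma((m+1)/2)$ is the area of $S^m$ (so $\sigma_0=2$; note $\sigma$ without index is a real parameter). $V_{n+1,n-k}$ is the Stiefel manifold of real $(n+1)\times(n-k)$ matrices $v$ with $v^Tv=I_{n-k}$. For $x\in S^n$ (a column vector), $|x^Tv|$ is the Euclidean norm of the row vector $x^Tv$. Constants and polynomials: $d_n(j)=(n+2j-1)\dfrac{\Gamma(n+j-1)}{\Gamma(j+1)\Gamma(n)}$ is the dimension of the space of spherical harmonics of degree $j$ on $S^n$; $R^{(\rho,\sigma)}_m(t)=P^{(\rho,\sigma)}_m(t)/P^{(\rho,\sigma)}_m(1)$ is the normalized Jacobi polynomial; for $j$ even, $$\varkappa_j=\left[\frac{\sigma_n\,(2j+n-1)\,\Gamma\left(\frac{j+k+1}{2}\right)\Gamma\left(\frac{j+n-1}{2}\right)}{\sigma_{n-k-1}\sigma_k\,\Gamma^2\left(\frac{k+1}{2}\right)\Gamma\left(\frac j2+1\right)\Gamma\left(\frac{j+n-k}{2}\right)}\right]^{1/2}.$$ *)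

theory Defs
  imports "HOL-Analysis.Analysis"
begin

section \<open>Surface measure on the unit sphere\<close>

text \<open>
  The surface measure is the one that appears in integration in polar coordinates: in dimension
  \<open>N\<close>, the area of \<open>A\<close> is \<open>N\<close> times the Lebesgue measure of the cone
  \<open>{t x | 0 < t \<le> 1, x \<in> A}\<close>. The space of this measure is the sphere itself, not the ambient
  space, so values of integrands outside the sphere are irrelevant (also for measurability).
\<close>

definition sphere_surface :: "'a::euclidean_space measure" where
  "sphere_surface =
     scale_measure (ennreal (real DIM('a)))
       (distr (restrict_space lborel (cball 0 1 - {0})) (restrict_space borel (sphere 0 1)) sgn)"

definition sphere_prob :: "'a::euclidean_space measure" where
  "sphere_prob = uniform_measure sphere_surface (sphere 0 1)"

text \<open>The area of the unit sphere of dimension \<open>m\<close> (in dimension \<open>m + 1\<close>).\<close>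

definition sphere_area :: "nat \<Rightarrow> real" where
  "sphere_area m = 2 * pi powr ((real m + 1) / 2) / Gamma ((real m + 1) / 2)"

lemma sphere_area_pos: "sphere_area m > 0"
  unfolding sphere_area_def by (intro divide_pos_pos mult_pos_pos Gamma_real_pos) auto

lemma space_sphere_surface [simp]: "space (sphere_surface :: 'a::euclidean_space measure) = sphere 0 1"
  by (simp add: sphere_surface_def space_restrict_space space_scale_measure)

lemma sets_sphere_surface [simp]:
  "sets (sphere_surface :: 'a::euclidean_space measure) = sets (restrict_space borel (sphere 0 1))"
  by (simp add: sphere_surface_def)

lemma space_sphere_prob [simp]: "space (sphere_prob :: 'a::euclidean_space measure) = sphere 0 1"
  by (simp add: sphere_prob_def)

lemma sets_sphere_prob [simp]:
  "sets (sphere_prob :: 'a::euclidean_space measure) = sets (restrict_space borel (sphere 0 1))"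
  by (simp add: sphere_prob_def)

lemma measurable_sgn_sphere:
  "sgn \<in> measurable (restrict_space lborel (cball 0 1 - {0 :: 'a::euclidean_space}))
           (restrict_space borel (sphere 0 1))"
proof (rule measurable_restrict_space2)
  show "sgn \<in> space (restrict_space lborel (cball 0 1 - {0 :: 'a})) \<rightarrow> sphere 0 1"
    by (auto simp: space_restrict_space norm_sgn)
  have "(\<lambda>x::'a. x /\<^sub>R norm x) \<in> borel_measurable borel"
    by measurable
  hence "(sgn :: 'a \<Rightarrow> 'a) \<in> borel_measurable borel"
    by (simp add: sgn_div_norm [abs_def])
  thus "(sgn :: 'a \<Rightarrow> 'a) \<in> borel_measurable (restrict_space lborel (cball 0 1 - {0}))"
    by (intro measurable_restrict_space1) simp
qed

lemma emeasure_sphere_surface: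
  assumes "DIM('a::euclidean_space) = m + 1"
  shows "emeasure (sphere_surface :: 'a measure) (sphere 0 1) = ennreal (sphere_area m)"
proof -
  let ?R = "restrict_space lborel (cball 0 1 - {0 :: 'a})"
  have eq: "sgn -` sphere 0 1 \<inter> space ?R = cball 0 1 - {0 :: 'a}"
    by (auto simp: space_restrict_space norm_sgn)
  have S: "sphere 0 1 \<in> sets (restrict_space borel (sphere (0::'a) 1))"
    by (simp add: sets_restrict_space_iff)
  have "emeasure (distr ?R (restrict_space borel (sphere 0 1)) sgn) (sphere 0 1) = emeasure ?R (cball 0 1 - {0})"
    by (subst emeasure_distr [OF measurable_sgn_sphere S]) (simp only: eq)
  also have "\<dots> = emeasure lborel (cball 0 1 - {0 :: 'a})"
    by (subst emeasure_restrict_space) auto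
  also have "\<dots> = emeasure lborel (cball (0::'a) 1)"
    by (subst emeasure_Diff) auto
  also have "\<dots> = ennreal (unit_ball_vol (real (m + 1)))"
    using emeasure_cball [of 1 "0::'a"] assms by simp
  finally have "emeasure (sphere_surface :: 'a measure) (sphere 0 1) =
      ennreal (real (m + 1)) * ennreal (unit_ball_vol (real (m + 1)))"
    unfolding sphere_surface_def emeasure_scale_measure by (simp add: assms)
  also have "\<dots> = ennreal (real (m + 1) * unit_ball_vol (real (m + 1)))"
    by (simp add: ennreal_mult)
  also have "real (m + 1) * unit_ball_vol (real (m + 1)) = sphere_area m"
  proof -
    have G: "Gamma ((real m + 1) / 2 + 1) = (real m + 1) / 2 * Gamma ((real m + 1) / 2)"
      by (rule Gamma_plus1) (auto simp: elim!: nonpos_Ints_cases)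
    have "Gamma ((real m + 1) / 2) \<noteq> 0" "real m + 1 \<noteq> 0"
      using Gamma_real_pos [of "(real m + 1) / 2"] by (simp_all add: less_imp_neq [symmetric])
    thus ?thesis
      unfolding unit_ball_vol_def sphere_area_def of_nat_add of_nat_1 G
      by (simp add: divide_simps)
  qed
  finally show ?thesis .
qed

lemma emeasure_sphere_prob:
  "emeasure (sphere_prob :: 'a::euclidean_space measure) (sphere 0 1) = 1"
proof -
  obtain m where m: "DIM('a) = m + 1"
    using DIM_positive [where 'a = 'a] by (metis Suc_eq_plus1 Suc_pred)
  show ?thesis
    unfolding sphere_prob_def
    by (rule emeasure_uniform_measure_1)
       (use sphere_area_pos [of m] in \<open>auto simp: emeasure_sphere_surface [OF m]\<close>)
qed


section \<open>Spherical harmonics\<close>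

definition laplacian :: "('a::euclidean_space \<Rightarrow> real) \<Rightarrow> 'a \<Rightarrow> real" where
  "laplacian f x = (\<Sum>b\<in>Basis. (deriv ^^ 2) (\<lambda>t. f (x + t *\<^sub>R b)) 0)"

text \<open>
  Restrictions to the sphere of homogeneous harmonic polynomials; only the values of the
  function on the sphere matter.
\<close>

definition spherical_harmonic :: "nat \<Rightarrow> ('a::euclidean_space \<Rightarrow> real) \<Rightarrow> bool" where
  "spherical_harmonic j f \<longleftrightarrow>
     (\<exists>p. real_polynomial_function p \<and>
          (\<forall>c x. p (c *\<^sub>R x) = c ^ j * p x) \<and>
          (\<forall>x. laplacian p x = 0) \<and>
          (\<forall>x\<in>sphere 0 1. f x = p x))"

definition orthonormal_basis_L2 :: "'a measure \<Rightarrow> 'i set \<Rightarrow> ('i \<Rightarrow> 'a \<Rightarrow> real) \<Rightarrow> bool" where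
  "orthonormal_basis_L2 M I e \<longleftrightarrow>
     (\<forall>i\<in>I. e i \<in> borel_measurable M \<and> integrable M (\<lambda>x. (e i x)\<^sup>2)) \<and>
     (\<forall>i\<in>I. \<forall>i'\<in>I. (LINT x|M. e i x * e i' x) = (if i = i' then 1 else 0)) \<and>
     (\<forall>f \<in> borel_measurable M. integrable M (\<lambda>x. (f x)\<^sup>2) \<longrightarrow>
        (\<forall>\<epsilon>>0. \<exists>F c. finite F \<and> F \<subseteq> I \<and> (LINT x|M. (f x - (\<Sum>i\<in>F. c i * e i x))\<^sup>2) < \<epsilon>))"

text \<open>
  The dimension \<open>d\<^sub>n(j)\<close>. The floor only serves to obtain a natural number, the argument being
  integral already: see \<open>harmonic_dim_eq\<close>.
\<close>

definition harmonic_dim :: "nat \<Rightarrow> nat \<Rightarrow> nat" where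
  "harmonic_dim n j =
     nat \<lfloor>(real n + 2 * real j - 1) *
           (Gamma (real n + real j - 1) / (Gamma (real j + 1) * Gamma (real n)))\<rfloor>"

lemma harmonic_dim_eq:
  assumes "n \<ge> 2"
  shows "real (harmonic_dim n j) =
     (real n + 2 * real j - 1) *
       (Gamma (real n + real j - 1) / (Gamma (real j + 1) * Gamma (real n)))" (is "_ = ?D")
proof -
  obtain a where n: "n = Suc (Suc a)"
    using assms by (metis add_2_eq_Suc le_Suc_ex)
  have G: "Gamma (real n + real j - 1) = fact (a + j)" "Gamma (real j + 1) = fact j"
    "Gamma (real n) = fact (a + 1)"
    using Gamma_fact [of "a + j", where 'a = real] Gamma_fact [of j, where 'a = real]
      Gamma_fact [of "a + 1", where 'a = real]
    by (simp_all add: n add_ac)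
  have "\<exists>d::nat. ?D = real d"
  proof (cases j)
    case 0
    show ?thesis
      by (rule exI [of _ 1]) (simp only: G, simp add: 0 n)
  next
    case (Suc i)
    have "real ((a + j + 1) choose j) = fact (a + j + 1) / (fact j * fact (a + 1))"
      by (subst binomial_fact) auto
    moreover have "real ((a + j) choose i) = fact (a + j) / (fact i * fact (a + 1))"
      by (subst binomial_fact) (auto simp: Suc)
    moreover have "?D = fact (a + j + 1) / (fact j * fact (a + 1)) + fact (a + j) / (fact i * fact (a + 1))"
    proof -
      have "?D = (real (a + j + 1) + real j) * (fact (a + j) / (fact j * fact (a + 1)))"
        by (simp only: G) (simp add: n add_ac)
      also have "\<dots> = real (a + j + 1) * fact (a + j) / (fact j * fact (a + 1)) +
          real j * fact (a + j) / (fact j * fact (a + 1))"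
        by (simp only: distrib_right times_divide_eq_right add_divide_distrib)
      also have "real (a + j + 1) * fact (a + j) = fact (a + j + 1)"
        by simp
      also have "real j * fact (a + j) / (fact j * fact (a + 1)) = fact (a + j) / (fact i * fact (a + 1))"
        by (simp only: Suc fact_Suc [of i] of_nat_mult mult.assoc) (simp del: of_nat_Suc fact_Suc)
      finally show ?thesis .
    qed
    ultimately show ?thesis
      by (intro exI [of _ "((a + j + 1) choose j) + ((a + j) choose i)"]) simp
  qed
  thus ?thesis
    unfolding harmonic_dim_def by force
qed

definition spherical_harmonic_basis ::
    "nat \<Rightarrow> (nat \<Rightarrow> nat \<Rightarrow> 'a::euclidean_space \<Rightarrow> real) \<Rightarrow> bool" where
  "spherical_harmonic_basis n Y \<longleftrightarrow>
     (\<forall>j. \<forall>l\<in>{1..harmonic_dim n j}. spherical_harmonic j (Y j l)) \<and>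
     orthonormal_basis_L2 sphere_prob (SIGMA j:UNIV. {1..harmonic_dim n j}) (\<lambda>(j, l). Y j l)"


section \<open>Jacobi polynomials and the transform\<close>

text \<open>
  Explicit form (Szego, Orthogonal Polynomials, (4.3.2)), in the standard normalization
  \<open>P(1) = (m + a) gchoose m\<close>.
\<close>

definition jacobi_poly :: "real \<Rightarrow> real \<Rightarrow> nat \<Rightarrow> real \<Rightarrow> real" where
  "jacobi_poly a b m t =
     (\<Sum>s\<le>m. ((real m + a) gchoose (m - s)) * ((real m + b) gchoose s) *
              ((t - 1) / 2) ^ s * ((t + 1) / 2) ^ (m - s))"

definition jacobi_normalized :: "real \<Rightarrow> real \<Rightarrow> nat \<Rightarrow> real \<Rightarrow> real" where
  "jacobi_normalized a b m t = jacobi_poly a b m t / jacobi_poly a b m 1"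

text \<open>Real matrices with \<open>'m\<close> rows and \<open>'q\<close> columns, the columns being orthonormal.\<close>

definition stiefel :: "(real ^ 'q ^ 'm) set" where
  "stiefel = {v. transpose v ** v = mat 1}"

definition kappa :: "nat \<Rightarrow> nat \<Rightarrow> nat \<Rightarrow> real" where
  "kappa n k j =
     sqrt (sphere_area n * (2 * real j + real n - 1) *
             Gamma ((real j + real k + 1) / 2) * Gamma ((real j + real n - 1) / 2) /
           (sphere_area (n - k - 1) * sphere_area k * (Gamma ((real k + 1) / 2))\<^sup>2 *
             Gamma (real j / 2 + 1) * Gamma ((real j + real n - real k) / 2)))"

definition alpha :: "nat \<Rightarrow> nat \<Rightarrow> nat \<Rightarrow> real" where
  "alpha n k j = kappa n k j * sqrt (real (harmonic_dim n j))"

text \<open>\<open>x v* v\<close> is the row vector \<open>x\<^sup>T v\<close>.\<close>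

definition jacobi_kernel :: "nat \<Rightarrow> nat \<Rightarrow> nat \<Rightarrow> real ^ 'm \<Rightarrow> real ^ 'q ^ 'm \<Rightarrow> real" where
  "jacobi_kernel n k j x v =
     jacobi_normalized ((real k - 1) / 2) ((real n - real k) / 2 - 1) (j div 2)
       (2 * (norm (x v* v))\<^sup>2 - 1)"

definition harmonic_hat ::
    "nat \<Rightarrow> nat \<Rightarrow> (nat \<Rightarrow> nat \<Rightarrow> real ^ 'm \<Rightarrow> real) \<Rightarrow> nat \<Rightarrow> nat \<Rightarrow> real ^ 'q ^ 'm \<Rightarrow> real" where
  "harmonic_hat n k Y j l v =
     alpha n k j * (LINT x|sphere_prob. Y j l x * jacobi_kernel n k j x v)"

end

theory Submission
  imports Defs
begin

text \<open>
  The two factors \<open>alpha\<close> cancel (they are positive), and what remains is the expansion of the kernel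
  \<open>x \<mapsto> R (2 |x\<^sup>T v|\<^sup>2 - 1)\<close> in the harmonics of degree \<open>j\<close> of the given basis. So two things have to be
  shown: that this kernel is itself a spherical harmonic of degree \<open>j\<close>, and that every spherical
  harmonic of degree \<open>j\<close> is the sum of its components along the basis members of that degree.

  The kernel depends only on the lengths of the components of \<open>x\<close> in the column space of \<open>v\<close> and in
  its orthogonal complement. If \<open>u\<close> and \<open>w\<close> denote their squares, then \<open>u + w = 1\<close> on the sphere, and
  the explicit Jacobi polynomial becomes a form of degree \<open>j / 2\<close> in \<open>u\<close> and \<open>w\<close>, hence
  a homogeneous polynomial of degree \<open>j\<close> in \<open>x\<close>. The Laplacian acts on the monomials in \<open>u\<close> and \<open>w\<close> by
  the radial Laplacians of the two subspaces (\<open>laplacian_projection_power\<close>), and the ratio of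
  consecutive coefficients is exactly what makes the result cancel (\<open>spherical_harmonic_jacobi\<close>).
  The Jacobi parameters are half the dimensions of the complement and of the column space, minus 1.

  For the second point, a harmonic of degree \<open>j\<close> minus its components of degree \<open>j\<close> is orthogonal to
  the whole basis, provided that harmonics of different degrees are orthogonal
  (\<open>integral_harmonic_polynomials_eq_0\<close>); by completeness it has norm zero, and being continuous it
  vanishes (\<open>spherical_harmonic_expansion\<close>). Orthogonality is Green's identity. The integration by
  parts behind it (\<open>integral_deriv_along_sphere\<close>) is derived on the sphere itself, from the
  invariance of the measure under rotations: the integral of the derivative of a function along a
  one-parameter group of rotations is zero.
\<close>

section \<open>Directional derivatives of polynomial functions\<close>

text \<open>
  The direction comes first, so that \<open>deriv_along b\<close> for fixed \<open>b\<close> is a differential operator that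
  can be iterated, while \<open>\<lambda>x. deriv_along x f x\<close> is the Euler (radial) derivative.
\<close>

definition deriv_along :: "'a::real_normed_vector \<Rightarrow> ('a \<Rightarrow> real) \<Rightarrow> 'a \<Rightarrow> real" where
  "deriv_along b f x = frechet_derivative f (at x) b"

lemma deriv_along_eqI: "(f has_derivative f') (at x) \<Longrightarrow> deriv_along b f x = f' b"
  unfolding deriv_along_def using frechet_derivative_at by metis

text \<open>
  Differentiability and polynomiality of the derivative go through the induction together: the
  product rule for the derivative needs both factors.
\<close>

lemma real_polynomial_function_derivative_exists:
  assumes "real_polynomial_function f"
  shows "\<exists>f'. (\<forall>x. (f has_derivative f' x) (at x)) \<and> (\<forall>b. real_polynomial_function (\<lambda>x. f' x b))"
  using assms
proof induction
  case (linear f)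
  then show ?case
    by (intro exI[of _ "\<lambda>_. f"]) (auto intro: bounded_linear_imp_has_derivative)
next
  case (const c)
  then show ?case by (intro exI[of _ "\<lambda>_ _. 0"]) auto
next
  case (add f g)
  then obtain f' g' where "\<And>x. (f has_derivative f' x) (at x)" "\<And>x. (g has_derivative g' x) (at x)"
    and "\<And>b. real_polynomial_function (\<lambda>x. f' x b)" "\<And>b. real_polynomial_function (\<lambda>x. g' x b)"
    by blast
  then show ?case
    by (intro exI[of _ "\<lambda>x b. f' x b + g' x b"]) (auto intro!: has_derivative_add)
next
  case (mult f g)
  then obtain f' g' where "\<And>x. (f has_derivative f' x) (at x)" "\<And>x. (g has_derivative g' x) (at x)"
    and "\<And>b. real_polynomial_function (\<lambda>x. f' x b)" "\<And>b. real_polynomial_function (\<lambda>x. g' x b)"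
    by blast
  with mult.hyps show ?case
    by (intro exI[of _ "\<lambda>x b. f x * g' x b + f' x b * g x"])
       (auto intro!: has_derivative_mult real_polynomial_function.intros(3,4))
qed

lemma has_derivative_deriv_along:
  assumes "real_polynomial_function f"
  shows "(f has_derivative (\<lambda>b. deriv_along b f x)) (at x)"
proof -
  obtain f' where f': "(f has_derivative f') (at x)"
    using real_polynomial_function_derivative_exists [OF assms] by blast
  then have "(\<lambda>b. deriv_along b f x) = f'"
    using deriv_along_eqI by blast
  with f' show ?thesis by simp
qed

lemma real_polynomial_function_deriv_along [intro]:
  assumes "real_polynomial_function f"
  shows "real_polynomial_function (deriv_along b f)"
proof -
  obtain f' where f': "\<And>x. (f has_derivative f' x) (at x)" "real_polynomial_function (\<lambda>x. f' x b)"
    using real_polynomial_function_derivative_exists [OF assms] by blast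
  have "deriv_along b f = (\<lambda>x. f' x b)"
    using deriv_along_eqI [OF f'(1)] by auto
  with f'(2) show ?thesis by simp
qed

lemma linear_deriv_along:
  assumes "real_polynomial_function f"
  shows "linear (\<lambda>b. deriv_along b f x)"
  using has_derivative_linear [OF has_derivative_deriv_along [OF assms]] .

lemma deriv_along_add:
  assumes "real_polynomial_function f" "real_polynomial_function g"
  shows "deriv_along b (\<lambda>x. f x + g x) x = deriv_along b f x + deriv_along b g x"
  by (rule deriv_along_eqI) (intro has_derivative_add has_derivative_deriv_along assms)

lemma deriv_along_diff:
  assumes "real_polynomial_function f" "real_polynomial_function g"
  shows "deriv_along b (\<lambda>x. f x - g x) x = deriv_along b f x - deriv_along b g x"
  by (rule deriv_along_eqI) (intro has_derivative_diff has_derivative_deriv_along assms)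

lemma deriv_along_mult:
  assumes "real_polynomial_function f" "real_polynomial_function g"
  shows "deriv_along b (\<lambda>x. f x * g x) x = f x * deriv_along b g x + deriv_along b f x * g x"
  by (rule deriv_along_eqI) (intro has_derivative_mult has_derivative_deriv_along assms)

lemma deriv_along_cmult:
  assumes "real_polynomial_function f"
  shows "deriv_along b (\<lambda>x. c * f x) x = c * deriv_along b f x"
  by (rule deriv_along_eqI) (intro has_derivative_mult_right has_derivative_deriv_along assms)

lemma deriv_along_sum:
  assumes "\<And>i. i \<in> I \<Longrightarrow> real_polynomial_function (f i)"
  shows "deriv_along b (\<lambda>x. \<Sum>i\<in>I. f i x) x = (\<Sum>i\<in>I. deriv_along b (f i) x)"
  by (rule deriv_along_eqI) (intro has_derivative_sum has_derivative_deriv_along assms)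

lemma deriv_along_power:
  assumes "real_polynomial_function f"
  shows "deriv_along b (\<lambda>x. f x ^ n) x = real n * f x ^ (n - 1) * deriv_along b f x"
proof -
  have "((\<lambda>x. f x ^ n) has_derivative (\<lambda>b. real n * deriv_along b f x * f x ^ (n - 1))) (at x)"
    by (intro has_derivative_power has_derivative_deriv_along assms)
  from deriv_along_eqI [OF this] show ?thesis by (simp add: mult_ac)
qed

lemma real_polynomial_function_inner_left [intro]:
  "real_polynomial_function (\<lambda>x::'a::real_inner. x \<bullet> a)"
  by (intro real_polynomial_function.intros(1) bounded_linear_inner_left)

lemma real_polynomial_function_quadratic_form:
  fixes Q :: "'a::euclidean_space \<Rightarrow> 'a"
  assumes "linear Q"
  shows "real_polynomial_function (\<lambda>x. x \<bullet> Q x)"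
proof -
  have "real_polynomial_function (\<lambda>x. Q x \<bullet> b)" for b
    using assms by (intro real_polynomial_function.intros(1) bounded_linear_inner_left_comp)
      (simp add: linear_linear)
  then show ?thesis
    by (subst euclidean_inner)
       (intro real_polynomial_function_sum real_polynomial_function.intros(4)
          real_polynomial_function_inner_left finite_Basis)
qed

lemma deriv_along_inner_left [simp]: "deriv_along b (\<lambda>x::'a::real_inner. x \<bullet> a) x = b \<bullet> a"
  by (rule deriv_along_eqI) (auto intro!: derivative_eq_intros)

lemma deriv_along_line:
  assumes "real_polynomial_function f"
  shows "((\<lambda>t. f (x + t *\<^sub>R b)) has_real_derivative deriv_along b f (x + t *\<^sub>R b)) (at t)"
proof -
  have "((\<lambda>t. x + t *\<^sub>R b) has_derivative (\<lambda>s. s *\<^sub>R b)) (at t)"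
    by (auto intro!: derivative_eq_intros)
  from has_derivative_compose [OF this has_derivative_deriv_along [OF assms]]
  show ?thesis
    unfolding has_field_derivative_def
    by (rule has_derivative_eq_rhs) (auto simp: linear_cmul [OF linear_deriv_along [OF assms]])
qed

lemma laplacian_polynomial:
  assumes "real_polynomial_function f"
  shows "laplacian f x = (\<Sum>b\<in>Basis. deriv_along b (deriv_along b f) x)"
  unfolding laplacian_def
proof (intro sum.cong refl)
  fix b :: 'a
  have 1: "deriv (\<lambda>t. f (x + t *\<^sub>R b)) = (\<lambda>t. deriv_along b f (x + t *\<^sub>R b))"
    by (intro ext DERIV_imp_deriv deriv_along_line assms)
  have "deriv (\<lambda>t. deriv_along b f (x + t *\<^sub>R b)) 0 = deriv_along b (deriv_along b f) (x + 0 *\<^sub>R b)"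
    by (intro DERIV_imp_deriv deriv_along_line real_polynomial_function_deriv_along assms)
  with 1 show "(deriv ^^ 2) (\<lambda>t. f (x + t *\<^sub>R b)) 0 = deriv_along b (deriv_along b f) x"
    by (simp add: numeral_2_eq_2)
qed

lemma deriv_along_expand:
  fixes f :: "'a::euclidean_space \<Rightarrow> real"
  assumes "real_polynomial_function f"
  shows "deriv_along h f x = (\<Sum>b\<in>Basis. (h \<bullet> b) * deriv_along b f x)"
proof -
  have "deriv_along h f x = deriv_along (\<Sum>b\<in>Basis. (h \<bullet> b) *\<^sub>R b) f x"
    by (simp add: euclidean_representation)
  also have "\<dots> = (\<Sum>b\<in>Basis. (h \<bullet> b) * deriv_along b f x)"
    by (simp add: linear_sum [OF linear_deriv_along [OF assms]] linear_cmul [OF linear_deriv_along [OF assms]])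
  finally show ?thesis .
qed

lemma real_polynomial_function_deriv_radial [intro]:
  fixes f :: "'a::euclidean_space \<Rightarrow> real"
  assumes "real_polynomial_function f"
  shows "real_polynomial_function (\<lambda>x. deriv_along x f x)"
proof -
  have "(\<lambda>x. deriv_along x f x) = (\<lambda>x. \<Sum>b\<in>Basis. (x \<bullet> b) * deriv_along b f x)"
    by (intro ext deriv_along_expand assms)
  then show ?thesis
    by (auto intro!: real_polynomial_function_sum real_polynomial_function.intros(4) assms)
qed

lemma euler_homogeneous:
  assumes "real_polynomial_function f" and hom: "\<And>c x. f (c *\<^sub>R x) = c ^ j * f x"
  shows "deriv_along x f x = real j * f x"
proof -
  have "((\<lambda>t. f (x + t *\<^sub>R x)) has_real_derivative deriv_along x f x) (at 0)"
    using deriv_along_line [OF assms(1), of x x 0] by simp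
  moreover have "(\<lambda>t. f (x + t *\<^sub>R x)) = (\<lambda>t. (1 + t) ^ j * f x)"
    by (simp flip: hom add: scaleR_add_left)
  moreover have "((\<lambda>t. (1 + t) ^ j * f x) has_real_derivative real j * f x) (at 0)"
    by (auto intro!: derivative_eq_intros)
  ultimately show ?thesis using DERIV_unique by metis
qed

lemma real_polynomial_function_imp_continuous_on:
  fixes f :: "'a::euclidean_space \<Rightarrow> real"
  shows "real_polynomial_function f \<Longrightarrow> continuous_on S f"
  using continuous_on_polymonial_function real_polynomial_function_eq by blast

section \<open>Rotation invariance and full support of the sphere measure\<close>

lemma finite_measure_sphere_prob: "finite_measure (sphere_prob :: 'a::euclidean_space measure)"
  by (intro finite_measureI) (simp add: emeasure_sphere_prob)

lemma integrable_sphere_prob_continuous: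
  fixes f :: "'a::euclidean_space \<Rightarrow> real"
  assumes "continuous_on (sphere 0 1) f"
  shows "integrable sphere_prob f"
proof -
  interpret finite_measure "sphere_prob :: 'a measure" by (rule finite_measure_sphere_prob)
  have "compact (f ` sphere 0 1)"
    by (intro compact_continuous_image assms compact_sphere)
  then obtain B where "\<And>x. x \<in> sphere 0 1 \<Longrightarrow> norm (f x) \<le> B"
    using compact_imp_bounded bounded_iff by (metis image_eqI)
  moreover have "f \<in> borel_measurable sphere_prob"
    using borel_measurable_continuous_on_restrict [OF assms]
    by (simp cong: measurable_cong_sets)
  ultimately show ?thesis
    by (intro integrable_const_bound [where B = B]) auto
qed

text \<open>
  The truncated cone through which the surface measure is defined; it turns statements about the
  sphere into statements about Lebesgue measure.
\<close>

definition cone_over :: "'a::euclidean_space set \<Rightarrow> 'a set" where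
  "cone_over A = {y \<in> cball 0 1 - {0}. sgn y \<in> A}"

lemma cone_over_borel:
  assumes "A \<in> sets (sphere_prob :: 'a::euclidean_space measure)"
  shows "cone_over A \<in> sets borel"
proof -
  have "sgn -` A \<inter> space (restrict_space lborel (cball 0 1 - {0})) \<in>
      sets (restrict_space lborel (cball 0 1 - {0 :: 'a}))"
    by (rule measurable_sets [OF measurable_sgn_sphere]) (use assms in simp)
  moreover have "sgn -` A \<inter> space (restrict_space lborel (cball 0 1 - {0})) = cone_over A"
    by (auto simp: cone_over_def space_restrict_space)
  ultimately show ?thesis
    by (simp add: sets_restrict_space_iff)
qed

lemma emeasure_sphere_prob_cone:
  assumes "A \<in> sets (sphere_prob :: 'a::euclidean_space measure)"
  shows "emeasure sphere_prob A = emeasure lborel (cone_over A) / emeasure lborel (cball (0::'a) 1)"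
proof -
  let ?R = "restrict_space lborel (cball 0 1 - {0 :: 'a})"
  have surf: "emeasure sphere_surface A = ennreal DIM('a) * emeasure lborel (cone_over A)"
    if "A \<in> sets (sphere_prob :: 'a measure)" for A :: "'a set"
  proof -
    have "sgn -` A \<inter> space ?R = cone_over A"
      by (auto simp: cone_over_def space_restrict_space)
    moreover have "emeasure ?R (cone_over A) = emeasure lborel (cone_over A)"
      by (subst emeasure_restrict_space) (auto simp: cone_over_def)
    ultimately show ?thesis
      using that by (simp add: sphere_surface_def emeasure_distr [OF measurable_sgn_sphere])
  qed
  have S: "sphere 0 1 \<in> sets (sphere_prob :: 'a measure)"
    using sets.top [of "sphere_prob :: 'a measure"] by simp
  have "cone_over (sphere 0 1) = cball 0 1 - {0 :: 'a}"
    by (auto simp: cone_over_def norm_sgn)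
  moreover have "emeasure lborel (cball 0 1 - {0 :: 'a}) = emeasure lborel (cball (0::'a) 1)"
    by (subst emeasure_Diff) auto
  ultimately have "emeasure sphere_surface (sphere (0::'a) 1) = ennreal DIM('a) * emeasure lborel (cball (0::'a) 1)"
    using surf [OF S] by simp
  moreover have "A \<subseteq> sphere 0 1"
    using sets.sets_into_space [OF assms] by simp
  moreover have "emeasure sphere_prob A = emeasure sphere_surface (sphere 0 1 \<inter> A) / emeasure sphere_surface (sphere (0::'a) 1)"
    using assms S unfolding sphere_prob_def by (subst emeasure_uniform_measure) auto
  ultimately show ?thesis
    using surf [OF assms] by (simp add: Int_absorb1 divide_mult_eq mult.commute [of "ennreal (real DIM('a))"])
qed

lemma nn_integral_lborel_translate:
  fixes f :: "'a::euclidean_space \<Rightarrow> ennreal"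
  assumes "f \<in> borel_measurable borel"
  shows "(\<integral>\<^sup>+ x. f (c + x) \<partial>lborel) = (\<integral>\<^sup>+ x. f x \<partial>lborel)"
proof -
  have "(\<integral>\<^sup>+ x. f x \<partial>distr lborel borel ((+) c)) = (\<integral>\<^sup>+ x. f (c + x) \<partial>lborel)"
    using assms by (intro nn_integral_distr) auto
  then show ?thesis by (simp add: lborel_distr_plus)
qed

text \<open>
  A translation invariant measure that is finite on balls is determined up to a factor, and the
  unit ball \<open>B\<close>, which \<open>T\<close> preserves, shows that the factor is 1. Concretely, the double integral
  of \<open>1\<^sub>A (T x + y) 1\<^sub>B (y)\<close> is computed in two ways. Integrating first over \<open>x\<close> and translating by
  the preimage of \<open>y\<close> gives the measure of \<open>T -` A\<close> times that of \<open>B\<close>; translating \<open>y\<close> by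
  \<open>- T x\<close> first gives the measure of \<open>A\<close> times that of \<open>B\<close>.
\<close>

lemma emeasure_lborel_orthogonal_vimage:
  fixes T :: "'a::euclidean_space \<Rightarrow> 'a"
  assumes T: "orthogonal_transformation T" and A: "A \<in> sets borel"
  shows "emeasure lborel (T -` A) = emeasure lborel A"
proof -
  define B where "B = ball (0::'a) 1"
  have [measurable]: "T \<in> borel_measurable borel" "A \<in> sets borel" "B \<in> sets borel"
    using T A by (auto simp: B_def linear_continuous_on orthogonal_transformation_linear linear_linear
        intro!: borel_measurable_continuous_onI)
  have TA [measurable]: "T -` A \<in> sets borel"
    using measurable_sets [of T borel borel A] by simp
  have linT: "linear T" and bijT: "bij T"
    using T by (auto simp: orthogonal_transformation_linear orthogonal_transformation_bij)
  have norm: "norm (T x) = norm x" for x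
    by (simp add: T orthogonal_transformation_norm)
  let ?I = "\<integral>\<^sup>+ x. (\<integral>\<^sup>+ y. indicator A (T x + y) * indicator B y \<partial>lborel) \<partial>(lborel :: 'a measure)"
  have "?I = (\<integral>\<^sup>+ y. (\<integral>\<^sup>+ x. indicator A (T x + y) * indicator B y \<partial>lborel) \<partial>(lborel :: 'a measure))"
    by (intro lborel_pair.Fubini' [symmetric]) measurable
  also have "\<dots> = (\<integral>\<^sup>+ y. emeasure lborel (T -` A) * indicator B y \<partial>(lborel :: 'a measure))"
  proof (rule nn_integral_cong)
    fix y :: 'a
    obtain z where z: "T z = y" using bij_is_surj [OF bijT] by (metis surjD)
    have "(\<integral>\<^sup>+ x. indicator A (T x + y) * indicator B y \<partial>(lborel :: 'a measure)) =
        (\<integral>\<^sup>+ x. indicator (T -` A) (z + x) \<partial>lborel) * indicator B y"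
      by (subst nn_integral_multc [symmetric])
         (auto simp: linear_add [OF linT] z add.commute indicator_def intro!: nn_integral_cong measurable_compose [OF _ borel_measurable_indicator])
    also have "(\<integral>\<^sup>+ x. indicator (T -` A) (z + x) \<partial>lborel) = (\<integral>\<^sup>+ x. indicator (T -` A) x \<partial>lborel)"
      by (rule nn_integral_lborel_translate) measurable
    finally show "(\<integral>\<^sup>+ x. indicator A (T x + y) * indicator B y \<partial>lborel) = emeasure lborel (T -` A) * indicator B y"
      by simp
  qed
  also have "\<dots> = emeasure lborel (T -` A) * emeasure lborel B"
    by (simp add: nn_integral_cmult)
  finally have 1: "?I = emeasure lborel (T -` A) * emeasure lborel B" .
  have "?I = (\<integral>\<^sup>+ x. (\<integral>\<^sup>+ y. indicator A y * indicator B (y - T x) \<partial>lborel) \<partial>(lborel :: 'a measure))"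
  proof (rule nn_integral_cong)
    fix x :: 'a
    show "(\<integral>\<^sup>+ y. indicator A (T x + y) * indicator B y \<partial>(lborel :: 'a measure)) =
        (\<integral>\<^sup>+ y. indicator A y * indicator B (y - T x) \<partial>lborel)"
      by (subst (2) nn_integral_lborel_translate [of _ "T x", symmetric]) auto
  qed
  also have "\<dots> = (\<integral>\<^sup>+ y. (\<integral>\<^sup>+ x. indicator A y * indicator B (y - T x) \<partial>lborel) \<partial>(lborel :: 'a measure))"
    by (intro lborel_pair.Fubini' [symmetric]) measurable
  also have "\<dots> = (\<integral>\<^sup>+ y. indicator A y * emeasure lborel B \<partial>(lborel :: 'a measure))"
  proof (rule nn_integral_cong)
    fix y :: 'a
    obtain z where z: "T z = y" using bij_is_surj [OF bijT] by (metis surjD)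
    \<comment> \<open>\<open>T\<close> is an isometry, so \<open>T x\<close> lies in the unit ball around \<open>y = T z\<close> iff \<open>x\<close> lies in the one around \<open>z\<close>.\<close>
    have "(\<integral>\<^sup>+ x. indicator A y * indicator B (y - T x) \<partial>(lborel :: 'a measure)) =
        (\<integral>\<^sup>+ x. indicator A y * indicator (ball z 1) x \<partial>(lborel :: 'a measure))"
      using norm [of "z - _"]
      by (intro nn_integral_cong) (auto simp: B_def indicator_def dist_norm linear_diff [OF linT] z norm_minus_commute [of _ y])
    also have "\<dots> = indicator A y * emeasure lborel (ball z 1)"
      by (rule nn_integral_cmult_indicator) auto
    also have "emeasure lborel (ball z 1) = emeasure lborel B"
      by (simp add: B_def emeasure_ball)
    finally show "(\<integral>\<^sup>+ x. indicator A y * indicator B (y - T x) \<partial>lborel) = indicator A y * emeasure lborel B" .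
  qed
  also have "\<dots> = emeasure lborel A * emeasure lborel B"
    by (simp add: nn_integral_multc)
  finally have 2: "?I = emeasure lborel A * emeasure lborel B" .
  have "unit_ball_vol (real DIM('a)) \<noteq> 0"
    using unit_ball_vol_pos [of "real DIM('a)"] by (metis less_irrefl of_nat_0_le_iff)
  then have "emeasure lborel B \<noteq> 0" "emeasure lborel B \<noteq> \<infinity>"
    by (auto simp: B_def emeasure_ball)
  with 1 2 show ?thesis
    by (metis ennreal_mult_divide_eq infinity_ennreal_def)
qed

lemma orthogonal_transformation_measurable_sphere_prob:
  fixes T :: "'a::euclidean_space \<Rightarrow> 'a"
  assumes T: "orthogonal_transformation T"
  shows "T \<in> measurable sphere_prob sphere_prob"
proof -
  have "T \<in> borel_measurable borel"
    using T by (auto simp: linear_continuous_on orthogonal_transformation_linear linear_linear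
        intro!: borel_measurable_continuous_onI)
  then show ?thesis
    unfolding measurable_cong_sets [OF sets_sphere_prob sets_sphere_prob]
    by (intro measurable_restrict_space3) (auto simp: T orthogonal_transformation_norm)
qed

lemma distr_sphere_prob_orthogonal:
  fixes T :: "'a::euclidean_space \<Rightarrow> 'a"
  assumes T: "orthogonal_transformation T"
  shows "distr sphere_prob sphere_prob T = sphere_prob"
proof (rule measure_eqI)
  note meas = orthogonal_transformation_measurable_sphere_prob [OF T]
  have norm: "norm (T x) = norm x" for x
    by (simp add: T orthogonal_transformation_norm)
  have Tsgn: "sgn (T x) = T (sgn x)" for x
    by (simp add: sgn_div_norm norm T orthogonal_transformation_linear linear_cmul)
  fix A :: "'a set"
  assume "A \<in> sets (distr sphere_prob sphere_prob T)"
  then have A: "A \<in> sets sphere_prob" by simp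
  let ?A' = "T -` A \<inter> sphere 0 1"
  have A': "?A' \<in> sets sphere_prob"
    using measurable_sets [OF meas A] by simp
  have "y \<in> cone_over ?A' \<longleftrightarrow> T y \<in> cone_over A" for y
    using norm [of y] by (auto simp: cone_over_def Tsgn norm_sgn)
  then have "cone_over ?A' = T -` cone_over A"
    by blast
  then have "emeasure lborel (cone_over ?A') = emeasure lborel (cone_over A)"
    using emeasure_lborel_orthogonal_vimage [OF T cone_over_borel [OF A]] by simp
  then show "emeasure (distr sphere_prob sphere_prob T) A = emeasure sphere_prob A"
    using A A' meas by (simp add: emeasure_distr emeasure_sphere_prob_cone)
qed simp

lemma integral_sphere_prob_orthogonal:
  fixes T :: "'a::euclidean_space \<Rightarrow> 'a" and f :: "'a \<Rightarrow> real"
  assumes T: "orthogonal_transformation T" and f: "continuous_on (sphere 0 1) f"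
  shows "(LINT x|sphere_prob. f (T x)) = (LINT x|sphere_prob. f x)"
proof -
  have "(LINT x|sphere_prob. f x) = (LINT x|distr sphere_prob sphere_prob T. f x)"
    by (simp add: distr_sphere_prob_orthogonal [OF T])
  also have "\<dots> = (LINT x|sphere_prob. f (T x))"
    by (intro integral_distr orthogonal_transformation_measurable_sphere_prob [OF T] borel_measurable_integrable
        integrable_sphere_prob_continuous f)
  finally show ?thesis by simp
qed

text \<open>
  The sphere measure has full support: if \<open>f\<close> did not vanish at some point, then the cone over
  \<open>{f \<noteq> 0}\<close> would contain a nonempty open set, although it is a null set.
\<close>

lemma integral_square_sphere_prob_eq_0:
  fixes f :: "'a::euclidean_space \<Rightarrow> real"
  assumes cont: "continuous_on (sphere 0 1) f" and int: "(LINT x|sphere_prob. (f x)\<^sup>2) = 0"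
    and x: "x \<in> sphere 0 1"
  shows "f x = 0"
proof (rule ccontr)
  assume nz: "f x \<noteq> 0"
  define A where "A = {x \<in> sphere 0 1. f x \<noteq> 0}"
  have fm: "f \<in> borel_measurable sphere_prob"
    by (intro borel_measurable_integrable integrable_sphere_prob_continuous cont)
  have A: "A \<in> sets sphere_prob"
  proof -
    have "f -` (- {0}) \<inter> space sphere_prob \<in> sets sphere_prob"
      by (intro measurable_sets [OF fm]) auto
    also have "f -` (- {0}) \<inter> space sphere_prob = A"
      by (auto simp: A_def)
    finally show ?thesis .
  qed
  have "AE x in sphere_prob. (f x)\<^sup>2 = 0"
    using int by (subst (asm) integral_nonneg_eq_0_iff_AE)
      (auto intro!: integrable_sphere_prob_continuous continuous_intros cont)
  then have "emeasure sphere_prob A = 0"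
    using A by (subst (asm) AE_iff_measurable [OF A]) (auto simp: A_def)
  then have "emeasure lborel (cone_over A) = 0"
    using emeasure_cball [of 1 "0::'a"] by (simp add: emeasure_sphere_prob_cone [OF A] ennreal_divide_eq_0_iff)
  then have "cone_over A \<in> null_sets lborel"
    using cone_over_borel [OF A] by (simp add: null_sets_def)
  then have neg: "negligible (cone_over A)"
    by (simp add: negligible_iff_null_sets null_sets_completionI)
  define U where "U = {y \<in> ball 0 1 - {0}. f (sgn y) \<noteq> 0}"
  have "U = (ball 0 1 - {0}) \<inter> (\<lambda>y. f (sgn y)) -` (- {0})"
    by (auto simp: U_def split: if_splits)
  moreover have "continuous_on (ball 0 1 - {0}) (\<lambda>y. f (sgn y))"
    by (intro continuous_on_compose2 [OF cont] continuous_intros) (auto simp: norm_sgn split: if_splits)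
  ultimately have "open U"
    by (auto intro!: continuous_open_preimage open_delete)
  moreover have "(1/2) *\<^sub>R x \<in> U"
    using x nz by (auto simp: U_def sgn_div_norm)
  moreover have "negligible U"
    by (rule negligible_subset [OF neg]) (auto simp: U_def A_def cone_over_def norm_sgn)
  ultimately show False
    using open_not_negligible by blast
qed

section \<open>Integration by parts on the sphere\<close>

lemma deriv_along_rotation:
  fixes f :: "'a::euclidean_space \<Rightarrow> real"
  assumes f: "real_polynomial_function f"
  shows "deriv_along ((x \<bullet> a) *\<^sub>R b - (x \<bullet> b) *\<^sub>R a) f x =
    (x \<bullet> a) * deriv_along b f x - (x \<bullet> b) * deriv_along a f x"
  by (simp add: linear_diff [OF linear_deriv_along [OF f]] linear_cmul [OF linear_deriv_along [OF f]])

text \<open>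
  The operator is the generator of the rotations \<open>R \<theta>\<close> in the plane of \<open>a\<close> and \<open>b\<close>, and the
  integral of \<open>f \<circ> R \<theta>\<close> does not depend on \<open>\<theta>\<close>. So the difference quotients at \<open>\<theta> = 0\<close> integrate
  to zero, and dominated convergence passes to the derivative.
\<close>

lemma integral_deriv_along_rotation:
  fixes f :: "'a::euclidean_space \<Rightarrow> real"
  assumes f: "real_polynomial_function f" and ab: "a \<in> Basis" "b \<in> Basis" "a \<noteq> b"
  shows "(LINT x|sphere_prob. (x \<bullet> a) * deriv_along b f x - (x \<bullet> b) * deriv_along a f x) = 0"
proof -
  define L where "L x = (x \<bullet> a) * deriv_along b f x - (x \<bullet> b) * deriv_along a f x" for x
  define R where "R \<theta> x = x + ((cos \<theta> - 1) * (x \<bullet> a) - sin \<theta> * (x \<bullet> b)) *\<^sub>R a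
      + (sin \<theta> * (x \<bullet> a) + (cos \<theta> - 1) * (x \<bullet> b)) *\<^sub>R b" for \<theta> and x :: 'a
  note ip = inner_same_Basis [OF ab(1)] inner_same_Basis [OF ab(2)]
    inner_not_same_Basis [OF ab] inner_not_same_Basis [OF ab(2,1) ab(3)[symmetric]]
  have Ra: "R \<theta> x \<bullet> a = cos \<theta> * (x \<bullet> a) - sin \<theta> * (x \<bullet> b)"
    and Rb: "R \<theta> x \<bullet> b = sin \<theta> * (x \<bullet> a) + cos \<theta> * (x \<bullet> b)" for \<theta> x
    by (simp_all add: R_def inner_add_left ip algebra_simps)
  have orth: "orthogonal_transformation (R \<theta>)" for \<theta>
    unfolding orthogonal_transformation_def
  proof (intro conjI allI)
    show "linear (R \<theta>)"
      by (intro linearI) (simp_all add: R_def inner_add_left algebra_simps)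
    fix x y :: 'a
    have "sin \<theta> * sin \<theta> = 1 - cos \<theta> * cos \<theta>"
      using sin_squared_eq [of \<theta>] by (simp add: power2_eq_square)
    then have "((cos \<theta> - 1) * (x \<bullet> a) - sin \<theta> * (x \<bullet> b)) * (y \<bullet> a)
        + (sin \<theta> * (x \<bullet> a) + (cos \<theta> - 1) * (x \<bullet> b)) * (y \<bullet> b)
        + ((cos \<theta> - 1) * (y \<bullet> a) - sin \<theta> * (y \<bullet> b)) * (cos \<theta> * (x \<bullet> a) - sin \<theta> * (x \<bullet> b))
        + (sin \<theta> * (y \<bullet> a) + (cos \<theta> - 1) * (y \<bullet> b)) * (sin \<theta> * (x \<bullet> a) + cos \<theta> * (x \<bullet> b)) = 0"
      by algebra
    moreover have "R \<theta> x \<bullet> R \<theta> y = R \<theta> x \<bullet> y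
        + ((cos \<theta> - 1) * (y \<bullet> a) - sin \<theta> * (y \<bullet> b)) * (R \<theta> x \<bullet> a)
        + (sin \<theta> * (y \<bullet> a) + (cos \<theta> - 1) * (y \<bullet> b)) * (R \<theta> x \<bullet> b)"
      by (subst (2) R_def) (simp add: inner_add_right)
    moreover have "R \<theta> x \<bullet> y = x \<bullet> y + ((cos \<theta> - 1) * (x \<bullet> a) - sin \<theta> * (x \<bullet> b)) * (y \<bullet> a)
        + (sin \<theta> * (x \<bullet> a) + (cos \<theta> - 1) * (x \<bullet> b)) * (y \<bullet> b)"
      by (simp add: R_def inner_add_left inner_commute [of a y] inner_commute [of b y])
    ultimately show "R \<theta> x \<bullet> R \<theta> y = x \<bullet> y"
      unfolding Ra Rb by linarith
  qed
  have dR: "((\<lambda>\<theta>. f (R \<theta> x)) has_real_derivative L (R \<theta> x)) (at \<theta>)" for \<theta> x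
  proof -
    have "((\<lambda>\<theta>. R \<theta> x) has_derivative
        (\<lambda>h. h *\<^sub>R ((R \<theta> x \<bullet> a) *\<^sub>R b - (R \<theta> x \<bullet> b) *\<^sub>R a))) (at \<theta>)"
      unfolding Ra Rb unfolding R_def
      by (auto intro!: derivative_eq_intros simp: algebra_simps)
    from has_derivative_compose [OF this has_derivative_deriv_along [OF f]]
    show ?thesis
      unfolding has_field_derivative_def L_def
      by (rule has_derivative_eq_rhs)
         (auto simp: linear_cmul [OF linear_deriv_along [OF f]] deriv_along_rotation [OF f])
  qed
  have polyL: "real_polynomial_function L"
    unfolding L_def by (intro real_polynomial_function_diff real_polynomial_function.intros(4)
      real_polynomial_function_inner_left real_polynomial_function_deriv_along f)
  have cont: "continuous_on S f" "continuous_on S L" for S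
    by (intro real_polynomial_function_imp_continuous_on f polyL)+
  have contR: "continuous_on S (R \<theta>)" for \<theta> S
    using orth by (simp add: orthogonal_transformation_linear linear_continuous_on linear_linear)
  have sph: "R \<theta> x \<in> sphere 0 1" if "x \<in> sphere 0 1" for \<theta> x
    using that by (simp add: orthogonal_transformation_norm [OF orth])
  have "compact (L ` sphere 0 1)"
    by (intro compact_continuous_image cont compact_sphere)
  then obtain B where B: "\<And>x. x \<in> sphere 0 1 \<Longrightarrow> norm (L x) \<le> B"
    using compact_imp_bounded bounded_iff by (metis image_eqI)
  define s where "s n x = (f (R (inverse (Suc n)) x) - f x) / inverse (Suc n)" for n x
  have R0: "R 0 x = x" for x by (simp add: R_def)
  have meas: "g \<in> borel_measurable sphere_prob" if "continuous_on (sphere 0 1) g" for g :: "'a \<Rightarrow> real"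
    using integrable_sphere_prob_continuous [OF that] by auto
  have "(\<lambda>n. LINT x|sphere_prob. s n x) \<longlonglongrightarrow> (LINT x|sphere_prob. L x)"
  proof (rule integral_dominated_convergence [where w = "\<lambda>_. B"])
    show "L \<in> borel_measurable sphere_prob" by (intro meas cont)
    show "s n \<in> borel_measurable sphere_prob" for n
      unfolding s_def by (intro meas continuous_intros continuous_on_compose2 [OF cont(1) contR] cont) auto
    show "integrable sphere_prob (\<lambda>_::'a. B)"
      by (intro integrable_sphere_prob_continuous continuous_intros)
    show "AE x in sphere_prob. (\<lambda>n. s n x) \<longlonglongrightarrow> L x"
    proof (intro AE_I2)
      fix x :: 'a
      have "((\<lambda>h. (f (R h x) - f x) / h) \<longlongrightarrow> L x) (at 0)"
        using dR [of x 0] by (simp add: DERIV_def R0)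
      moreover have "filterlim (\<lambda>n. inverse (real (Suc n))) (at 0) sequentially"
        using LIMSEQ_inverse_real_of_nat by (auto simp: filterlim_at)
      ultimately show "(\<lambda>n. s n x) \<longlonglongrightarrow> L x"
        unfolding s_def by (rule filterlim_compose)
    qed
    show "AE x in sphere_prob. norm (s n x) \<le> B" for n
    proof (intro AE_I2)
      fix x :: 'a assume "x \<in> space sphere_prob"
      then have x: "x \<in> sphere 0 1" by simp
      \<comment> \<open>By the mean value theorem a difference quotient is a value of \<open>L\<close> on the sphere.\<close>
      obtain z where "f (R (inverse (Suc n)) x) - f (R 0 x) = (inverse (Suc n) - 0) * L (R z x)"
        using MVT2 [of 0 "inverse (Suc n)" "\<lambda>\<theta>. f (R \<theta> x)" "\<lambda>\<theta>. L (R \<theta> x)"] dR by auto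
      then have "s n x = L (R z x)"
        by (simp add: s_def R0)
      with B [OF sph [OF x]] show "norm (s n x) \<le> B" by simp
    qed
  qed
  moreover have "(LINT x|sphere_prob. s n x) = 0" for n
  proof -
    have "(LINT x|sphere_prob. s n x) =
        ((LINT x|sphere_prob. f (R (inverse (Suc n)) x)) - (LINT x|sphere_prob. f x)) / inverse (Suc n)"
      unfolding s_def
      by (subst integral_divide_zero, subst Bochner_Integration.integral_diff)
         (auto intro!: integrable_sphere_prob_continuous continuous_on_compose2 [OF cont(1) contR] cont)
    then show ?thesis
      by (simp add: integral_sphere_prob_orthogonal [OF orth cont(1)])
  qed
  ultimately show ?thesis
    by (simp add: LIMSEQ_const_iff flip: L_def)
qed

lemma integrable_sphere_prob_polynomial:
  fixes f :: "'a::euclidean_space \<Rightarrow> real"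
  shows "real_polynomial_function f \<Longrightarrow> integrable sphere_prob f"
  by (intro integrable_sphere_prob_continuous real_polynomial_function_imp_continuous_on)

text \<open>
  Integration by parts on the sphere. For each \<open>a \<noteq> b\<close> the rotation generator applied to
  \<open>(x \<bullet> a) g x\<close> has integral zero. In the sum over \<open>a\<close> the coefficients of the derivative along \<open>b\<close>
  add up to \<open>1 - (x \<bullet> b)\<^sup>2\<close> because \<open>x\<close> is a unit vector, and the other derivatives form the
  radial one except for the term \<open>a = b\<close>, which restores that coefficient to 1.
\<close>

lemma integral_deriv_along_sphere:
  fixes g :: "'a::euclidean_space \<Rightarrow> real"
  assumes g: "real_polynomial_function g" and b: "b \<in> Basis"
  shows "(LINT x|sphere_prob. deriv_along b g x) =
    (LINT x|sphere_prob. (x \<bullet> b) * (deriv_along x g x + (real DIM('a) - 1) * g x))"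
proof -
  define L where "L a x = (x \<bullet> a) * deriv_along b (\<lambda>x. (x \<bullet> a) * g x) x
      - (x \<bullet> b) * deriv_along a (\<lambda>x. (x \<bullet> a) * g x) x" for a x
  have poly: "real_polynomial_function (L a)" for a
    unfolding L_def by (intro real_polynomial_function_diff real_polynomial_function.intros(4)
      real_polynomial_function_inner_left real_polynomial_function_deriv_along g)
  have "(LINT x|sphere_prob. L a x) = 0" if "a \<in> Basis - {b}" for a
    unfolding L_def using that b
    by (intro integral_deriv_along_rotation) (auto intro!: g)
  then have "0 = (\<Sum>a\<in>Basis - {b}. LINT x|sphere_prob. L a x)"
    by simp
  also have "\<dots> = (LINT x|sphere_prob. (\<Sum>a\<in>Basis - {b}. L a x))"
    by (intro Bochner_Integration.integral_sum [symmetric] integrable_sphere_prob_polynomial poly)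
  also have "\<dots> = (LINT x|sphere_prob. deriv_along b g x
      - (x \<bullet> b) * (deriv_along x g x + (real DIM('a) - 1) * g x))"
  proof (intro Bochner_Integration.integral_cong refl)
    fix x :: 'a assume "x \<in> space sphere_prob"
    then have "norm x = 1" by simp
    then have "(\<Sum>a\<in>Basis. (x \<bullet> a) * (x \<bullet> a)) = 1"
      by (metis euclidean_inner norm_eq_1)
    then have *: "(\<Sum>a\<in>Basis - {b}. (x \<bullet> a) * (x \<bullet> a)) = 1 - (x \<bullet> b) * (x \<bullet> b)"
      using b by (simp add: sum_diff1)
    have **: "(\<Sum>a\<in>Basis - {b}. (x \<bullet> a) * deriv_along a g x) = deriv_along x g x - (x \<bullet> b) * deriv_along b g x"
      using b by (simp add: sum_diff1 flip: deriv_along_expand [OF g])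
    have "L a x = (x \<bullet> a) * (x \<bullet> a) * deriv_along b g x
        - (x \<bullet> b) * ((x \<bullet> a) * deriv_along a g x) - (x \<bullet> b) * g x"
      if "a \<in> Basis - {b}" for a
      using that b inner_not_same_Basis [of a b] inner_commute [of b a] unfolding L_def
      by (simp add: deriv_along_mult g real_polynomial_function_inner_left inner_same_Basis algebra_simps)
    then have "(\<Sum>a\<in>Basis - {b}. L a x) =
        (\<Sum>a\<in>Basis - {b}. (x \<bullet> a) * (x \<bullet> a)) * deriv_along b g x
        - (x \<bullet> b) * (\<Sum>a\<in>Basis - {b}. (x \<bullet> a) * deriv_along a g x)
        - (real DIM('a) - 1) * ((x \<bullet> b) * g x)"
      using b by (simp add: sum_subtractf sum_distrib_left sum_distrib_right of_nat_diff Suc_leI)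
    also have "\<dots> = deriv_along b g x - (x \<bullet> b) * (deriv_along x g x + (real DIM('a) - 1) * g x)"
      unfolding * ** by (simp add: algebra_simps)
    finally show "(\<Sum>a\<in>Basis - {b}. L a x) = \<dots>" .
  qed
  also have "\<dots> = (LINT x|sphere_prob. deriv_along b g x)
      - (LINT x|sphere_prob. (x \<bullet> b) * (deriv_along x g x + (real DIM('a) - 1) * g x))"
    by (intro Bochner_Integration.integral_diff integrable_sphere_prob_polynomial
        real_polynomial_function_deriv_along real_polynomial_function.intros(2-4)
        real_polynomial_function_inner_left real_polynomial_function_deriv_radial g)
  finally show ?thesis by simp
qed

text \<open>
  Green's identity on the sphere. The vector field \<open>g = p \<nabla>q - q \<nabla>p\<close> has divergence
  \<open>p \<Delta>q - q \<Delta>p = 0\<close>, and by Euler's identity its radial component \<open>h\<close> is \<open>(j - i) p q\<close>. Integration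
  by parts, applied to every component and summed, makes the integral of the divergence a multiple
  of the integral of \<open>h\<close>; the factor \<open>i + j + DIM('a) - 2\<close> is positive when \<open>i \<noteq> j\<close>.
\<close>

lemma integral_harmonic_polynomials_eq_0:
  fixes p q :: "'a::euclidean_space \<Rightarrow> real"
  assumes dim: "DIM('a) \<ge> 2"
    and p: "real_polynomial_function p" "\<And>c x. p (c *\<^sub>R x) = c ^ i * p x" "\<And>x. laplacian p x = 0"
    and q: "real_polynomial_function q" "\<And>c x. q (c *\<^sub>R x) = c ^ j * q x" "\<And>x. laplacian q x = 0"
    and ij: "i \<noteq> j"
  shows "(LINT x|sphere_prob. p x * q x) = 0"
proof -
  define g where "g b x = p x * deriv_along b q x - q x * deriv_along b p x" for b x
  define h where "h x = (real j - real i) * (p x * q x)" for x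
  have poly: "real_polynomial_function (g b)" for b
    unfolding g_def by (intro real_polynomial_function_diff real_polynomial_function.intros(4)
      real_polynomial_function_deriv_along p q)
  have polyh: "real_polynomial_function h"
    unfolding h_def by (intro real_polynomial_function.intros(2,4) p q)
  have radial: "(\<Sum>b\<in>Basis. (x \<bullet> b) * g b x) = h x" for x
  proof -
    have "(\<Sum>b\<in>Basis. (x \<bullet> b) * g b x) = p x * (\<Sum>b\<in>Basis. (x \<bullet> b) * deriv_along b q x)
        - q x * (\<Sum>b\<in>Basis. (x \<bullet> b) * deriv_along b p x)"
      by (simp add: g_def sum_distrib_left sum_subtractf right_diff_distrib mult_ac)
    also have "\<dots> = p x * deriv_along x q x - q x * deriv_along x p x"
      using p q by (simp flip: deriv_along_expand)
    also have "\<dots> = h x"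
      using euler_homogeneous [OF p(1,2)] euler_homogeneous [OF q(1,2)] by (simp add: h_def algebra_simps)
    finally show ?thesis .
  qed
  \<comment> \<open>Euler for \<open>h\<close>, of degree \<open>i + j\<close>; the \<open>- 1\<close> comes from differentiating the factors \<open>x \<bullet> b\<close>.\<close>
  have radial_deriv: "(\<Sum>b\<in>Basis. (x \<bullet> b) * deriv_along x (g b) x) = (real i + real j - 1) * h x" for x
  proof -
    have "deriv_along x h x = deriv_along x (\<lambda>y. \<Sum>b\<in>Basis. (y \<bullet> b) * g b y) x"
      by (simp add: radial)
    also have "\<dots> = (\<Sum>b\<in>Basis. (x \<bullet> b) * deriv_along x (g b) x) + (\<Sum>b\<in>Basis. (x \<bullet> b) * g b x)"
      by (subst deriv_along_sum)
         (auto simp: deriv_along_mult poly real_polynomial_function_inner_left sum.distrib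
            intro!: real_polynomial_function.intros(4))
    also have "deriv_along x h x = real (i + j) * h x"
      by (intro euler_homogeneous polyh) (simp add: h_def p q power_add)
    finally show ?thesis
      unfolding radial by (simp add: algebra_simps)
  qed
  have divergence: "(\<Sum>b\<in>Basis. deriv_along b (g b) x) = 0" for x
  proof -
    have "deriv_along b (g b) x = p x * deriv_along b (deriv_along b q) x - q x * deriv_along b (deriv_along b p) x" for b
      unfolding g_def
      by (subst deriv_along_diff)
         (auto simp: deriv_along_mult p q real_polynomial_function_deriv_along
           intro!: real_polynomial_function.intros(4))
    then have "(\<Sum>b\<in>Basis. deriv_along b (g b) x) = p x * laplacian q x - q x * laplacian p x"
      by (simp add: laplacian_polynomial p(1) q(1) sum_subtractf sum_distrib_left)
    then show ?thesis by (simp add: p q)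
  qed
  note polys = real_polynomial_function_deriv_along real_polynomial_function.intros(2-4)
        real_polynomial_function_inner_left real_polynomial_function_deriv_radial poly
  have "0 = (LINT x|sphere_prob. (\<Sum>b\<in>Basis. deriv_along b (g b) (x::'a)))"
    by (simp add: divergence)
  also have "\<dots> = (\<Sum>b\<in>Basis. LINT x|sphere_prob. deriv_along b (g b) x)"
    by (intro Bochner_Integration.integral_sum integrable_sphere_prob_polynomial polys)
  also have "\<dots> = (\<Sum>b\<in>Basis. LINT x|sphere_prob. (x \<bullet> b) * (deriv_along x (g b) x + (real DIM('a) - 1) * g b x))"
    by (intro sum.cong refl integral_deriv_along_sphere poly)
  also have "\<dots> = (LINT x|sphere_prob. (\<Sum>b\<in>Basis. (x \<bullet> b) * (deriv_along x (g b) x + (real DIM('a) - 1) * g b x)))"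
    by (intro Bochner_Integration.integral_sum [symmetric] integrable_sphere_prob_polynomial polys)
  also have "\<dots> = (LINT x|sphere_prob. (real i + real j + real DIM('a) - 2) * (real j - real i) * (p x * q x))"
  proof (intro Bochner_Integration.integral_cong refl)
    fix x :: 'a
    have "(\<Sum>b\<in>Basis. (x \<bullet> b) * (deriv_along x (g b) x + (real DIM('a) - 1) * g b x)) =
        (\<Sum>b\<in>Basis. (x \<bullet> b) * deriv_along x (g b) x) + (real DIM('a) - 1) * (\<Sum>b\<in>Basis. (x \<bullet> b) * g b x)"
      by (simp add: sum.distrib sum_distrib_left distrib_left mult_ac)
    also have "\<dots> = (real i + real j + real DIM('a) - 2) * h x"
      unfolding radial radial_deriv by (simp add: algebra_simps)
    finally show "(\<Sum>b\<in>Basis. (x \<bullet> b) * (deriv_along x (g b) x + (real DIM('a) - 1) * g b x)) =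
        (real i + real j + real DIM('a) - 2) * (real j - real i) * (p x * q x)"
      by (simp add: h_def)
  qed
  also have "\<dots> = (real i + real j + real DIM('a) - 2) * (real j - real i) * (LINT x|sphere_prob. p x * q x)"
    by (rule integral_mult_right_zero)
  finally show ?thesis
    using dim ij by auto
qed

section \<open>Expansion of a spherical harmonic in its own degree\<close>

lemma spherical_harmonic_continuous:
  assumes "spherical_harmonic j f"
  shows "continuous_on (sphere 0 1) f"
proof -
  obtain p where "real_polynomial_function p" "\<And>x. x \<in> sphere 0 1 \<Longrightarrow> f x = p x"
    using assms unfolding spherical_harmonic_def by blast
  then show ?thesis
    using real_polynomial_function_imp_continuous_on continuous_on_cong by metis
qed

lemma spherical_harmonic_orthogonal:
  fixes f g :: "'a::euclidean_space \<Rightarrow> real"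
  assumes "spherical_harmonic i f" "spherical_harmonic j g" "i \<noteq> j" "DIM('a) \<ge> 2"
  shows "(LINT x|sphere_prob. f x * g x) = 0"
proof -
  obtain p where p: "real_polynomial_function p" "\<And>c x. p (c *\<^sub>R x) = c ^ i * p x"
      "\<And>x. laplacian p x = 0" "\<And>x. x \<in> sphere 0 1 \<Longrightarrow> f x = p x"
    using assms(1) unfolding spherical_harmonic_def by blast
  obtain q where q: "real_polynomial_function q" "\<And>c x. q (c *\<^sub>R x) = c ^ j * q x"
      "\<And>x. laplacian q x = 0" "\<And>x. x \<in> sphere 0 1 \<Longrightarrow> g x = q x"
    using assms(2) unfolding spherical_harmonic_def by blast
  have "(LINT x|sphere_prob. f x * g x) = (LINT x|sphere_prob. p x * q x)"
    by (intro Bochner_Integration.integral_cong refl) (simp add: p q)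
  also have "\<dots> = 0"
    by (rule integral_harmonic_polynomials_eq_0 [OF assms(4) p(1-3) q(1-3) assms(3)])
  finally show ?thesis .
qed

lemma spherical_harmonic_lincomb:
  assumes f: "spherical_harmonic j f" and e: "\<And>l. l \<in> I \<Longrightarrow> spherical_harmonic j (e l)"
    and fin: "finite I"
  shows "spherical_harmonic j (\<lambda>x. f x - (\<Sum>l\<in>I. c l * e l x))"
proof -
  obtain p where p: "real_polynomial_function p" "\<And>c x. p (c *\<^sub>R x) = c ^ j * p x"
      "\<And>x. laplacian p x = 0" "\<And>x. x \<in> sphere 0 1 \<Longrightarrow> f x = p x"
    using f unfolding spherical_harmonic_def by blast
  have "\<forall>l\<in>I. \<exists>q. real_polynomial_function q \<and> (\<forall>c x. q (c *\<^sub>R x) = c ^ j * q x) \<and>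
      (\<forall>x. laplacian q x = 0) \<and> (\<forall>x\<in>sphere 0 1. e l x = q x)"
    using e unfolding spherical_harmonic_def by blast
  then obtain q where q: "\<And>l. l \<in> I \<Longrightarrow> real_polynomial_function (q l)"
      "\<And>l c x. l \<in> I \<Longrightarrow> q l (c *\<^sub>R x) = c ^ j * q l x"
      "\<And>l x. l \<in> I \<Longrightarrow> laplacian (q l) x = 0"
      "\<And>l x. l \<in> I \<Longrightarrow> x \<in> sphere 0 1 \<Longrightarrow> e l x = q l x"
    by metis
  define r where "r x = p x - (\<Sum>l\<in>I. c l * q l x)" for x
  have polys: "real_polynomial_function (\<lambda>x. c l * q l x)"
      "real_polynomial_function (\<lambda>x. c l * deriv_along b (q l) x)" if "l \<in> I" for l b
    using that by (auto intro!: real_polynomial_function.intros(2,4) q)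
  have polyr: "real_polynomial_function r"
    unfolding r_def by (intro real_polynomial_function_diff real_polynomial_function_sum p fin polys)
  have D: "deriv_along b r x = deriv_along b p x - (\<Sum>l\<in>I. c l * deriv_along b (q l) x)" for b x
    unfolding r_def
    by (simp add: deriv_along_diff deriv_along_sum deriv_along_cmult p q polys fin real_polynomial_function_sum)
  have DD: "deriv_along b (deriv_along b r) x =
      deriv_along b (deriv_along b p) x - (\<Sum>l\<in>I. c l * deriv_along b (deriv_along b (q l)) x)" for b x
    unfolding D [abs_def]
    by (simp add: deriv_along_diff deriv_along_sum deriv_along_cmult p q polys fin
        real_polynomial_function_sum real_polynomial_function_deriv_along)
  have "laplacian r x = laplacian p x - (\<Sum>l\<in>I. c l * laplacian (q l) x)" for x
  proof -
    have "laplacian r x = (\<Sum>b\<in>Basis. deriv_along b (deriv_along b p) x)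
        - (\<Sum>b\<in>Basis. \<Sum>l\<in>I. c l * deriv_along b (deriv_along b (q l)) x)"
      by (simp add: laplacian_polynomial polyr DD sum_subtractf)
    also have "(\<Sum>b\<in>Basis. \<Sum>l\<in>I. c l * deriv_along b (deriv_along b (q l)) x) =
        (\<Sum>l\<in>I. c l * laplacian (q l) x)"
      by (subst sum.swap) (simp add: laplacian_polynomial q sum_distrib_left)
    finally show ?thesis
      by (simp add: laplacian_polynomial p(1))
  qed
  then have "laplacian r x = 0" for x
    by (simp add: p q)
  moreover have "r (a *\<^sub>R x) = a ^ j * r x" for a x
    by (simp add: r_def p q right_diff_distrib sum_distrib_left mult_ac)
  moreover have "f x - (\<Sum>l\<in>I. c l * e l x) = r x" if "x \<in> sphere 0 1" for x
    using that by (simp add: r_def p q)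
  ultimately show ?thesis
    unfolding spherical_harmonic_def using polyr by blast
qed

text \<open>
  The remainder \<open>g\<close> of the expansion is again a harmonic of degree \<open>j\<close>. It is orthogonal to the
  basis elements of degree \<open>j\<close> by construction and to the others by the difference of degrees, so
  completeness of the basis makes it zero.
\<close>

lemma spherical_harmonic_expansion:
  fixes Y :: "nat \<Rightarrow> nat \<Rightarrow> 'a::euclidean_space \<Rightarrow> real"
  assumes dim: "DIM('a) \<ge> 2" and basis: "spherical_harmonic_basis n Y"
    and f: "spherical_harmonic j f" and x: "x \<in> sphere 0 1"
  shows "f x = (\<Sum>l = 1..harmonic_dim n j. Y j l x * (LINT y|sphere_prob. Y j l y * f y))"
proof -
  define I where "I = (SIGMA j:UNIV. {1..harmonic_dim n j})"
  define c where "c l = (LINT y|sphere_prob. Y j l y * f y)" for l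
  define g where "g x = f x - (\<Sum>l\<in>{1..harmonic_dim n j}. c l * Y j l x)" for x
  have Y: "spherical_harmonic i (Y i l)" if "(i, l) \<in> I" for i l
    using basis that unfolding spherical_harmonic_basis_def I_def by auto
  have ortho: "(LINT x|sphere_prob. Y i l x * Y i' l' x) = (if (i, l) = (i', l') then 1 else 0)"
    if "(i, l) \<in> I" "(i', l') \<in> I" for i l i' l'
    using basis that unfolding spherical_harmonic_basis_def orthonormal_basis_L2_def I_def by fastforce
  have harm: "spherical_harmonic j g"
    unfolding g_def by (intro spherical_harmonic_lincomb f Y) (auto simp: I_def)
  have cont: "continuous_on (sphere 0 1) g" "continuous_on (sphere 0 1) f"
      "\<And>i l. (i, l) \<in> I \<Longrightarrow> continuous_on (sphere 0 1) (Y i l)"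
    using harm f Y spherical_harmonic_continuous by blast+
  have orthog: "(LINT x|sphere_prob. g x * Y i l x) = 0" if il: "(i, l) \<in> I" for i l
  proof (cases "i = j")
    case False
    then show ?thesis
      using spherical_harmonic_orthogonal [OF harm Y [OF il] _ dim] by simp
  next
    case True
    have jI: "(j, m) \<in> I" if "m \<in> {1..harmonic_dim n j}" for m
      using that by (simp add: I_def)
    have "(LINT x|sphere_prob. g x * Y i l x) =
        (LINT x|sphere_prob. Y j l x * f x - (\<Sum>m\<in>{1..harmonic_dim n j}. c m * (Y j m x * Y j l x)))"
      unfolding g_def True left_diff_distrib sum_distrib_right
      by (intro Bochner_Integration.integral_cong refl) (simp only: mult_ac)
    also have "\<dots> = c l - (LINT x|sphere_prob. (\<Sum>m\<in>{1..harmonic_dim n j}. c m * (Y j m x * Y j l x)))"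
      unfolding c_def
      using il True jI by (intro Bochner_Integration.integral_diff integrable_sphere_prob_continuous continuous_intros cont) auto
    also have "(LINT x|sphere_prob. (\<Sum>m\<in>{1..harmonic_dim n j}. c m * (Y j m x * Y j l x))) =
        (\<Sum>m\<in>{1..harmonic_dim n j}. LINT x|sphere_prob. c m * (Y j m x * Y j l x))"
      using il True jI by (intro Bochner_Integration.integral_sum integrable_sphere_prob_continuous continuous_intros cont) auto
    also have "\<dots> = (\<Sum>m\<in>{1..harmonic_dim n j}. if m = l then c m else 0)"
      using il True jI by (intro sum.cong refl) (auto simp: ortho)
    also have "\<dots> = c l"
      using il True by (simp add: I_def)
    finally show ?thesis by simp
  qed
  have int_g2: "integrable sphere_prob (\<lambda>x. (g x)\<^sup>2)"
    by (intro integrable_sphere_prob_continuous continuous_intros cont)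
  \<comment> \<open>Since \<open>g\<close> is orthogonal to every approximant \<open>s\<close>, none is closer to \<open>g\<close> than 0 is.\<close>
  have "(LINT x|sphere_prob. (g x)\<^sup>2) < \<epsilon>" if "\<epsilon> > 0" for \<epsilon>
  proof -
    have complete: "\<forall>h \<in> borel_measurable sphere_prob. integrable sphere_prob (\<lambda>x. (h x)\<^sup>2) \<longrightarrow>
        (\<forall>\<epsilon>>0. \<exists>F c. finite F \<and> F \<subseteq> I \<and>
          (LINT x|sphere_prob. (h x - (\<Sum>i\<in>F. c i * (case i of (j, l) \<Rightarrow> Y j l) x))\<^sup>2) < \<epsilon>)"
      using basis unfolding spherical_harmonic_basis_def orthonormal_basis_L2_def I_def by blast
    have "g \<in> borel_measurable sphere_prob"
      by (intro borel_measurable_integrable integrable_sphere_prob_continuous cont)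
    from complete [rule_format, OF this int_g2 that] obtain F d where F: "finite F" "F \<subseteq> I" and
        less: "(LINT x|sphere_prob. (g x - (\<Sum>i\<in>F. d i * (case i of (j, l) \<Rightarrow> Y j l) x))\<^sup>2) < \<epsilon>"
      by auto
    define e where "e i = (case i of (j, l) \<Rightarrow> Y j l)" for i
    define s where "s x = (\<Sum>i\<in>F. d i * e i x)" for x
    have e_cont: "continuous_on (sphere 0 1) (e i)" if "i \<in> F" for i
      using that F by (cases i) (auto simp: e_def intro!: cont)
    have s_cont: "continuous_on (sphere 0 1) s"
      unfolding s_def by (intro continuous_intros e_cont)
    have "(LINT x|sphere_prob. g x * s x) = (LINT x|sphere_prob. (\<Sum>i\<in>F. d i * (g x * e i x)))"
      by (simp add: s_def sum_distrib_left mult_ac)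
    also have "\<dots> = (\<Sum>i\<in>F. LINT x|sphere_prob. d i * (g x * e i x))"
      by (intro Bochner_Integration.integral_sum integrable_sphere_prob_continuous continuous_intros cont e_cont)
    also have "\<dots> = 0"
      using F by (intro sum.neutral) (auto simp: e_def orthog)
    finally have gs: "(LINT x|sphere_prob. g x * s x) = 0" .
    have "(LINT x|sphere_prob. (g x)\<^sup>2) = (LINT x|sphere_prob. (g x)\<^sup>2) - 2 * (LINT x|sphere_prob. g x * s x)"
      by (simp add: gs)
    also have "\<dots> = (LINT x|sphere_prob. (g x)\<^sup>2 - 2 * (g x * s x))"
      by (subst Bochner_Integration.integral_diff)
         (auto intro!: integrable_sphere_prob_continuous continuous_intros cont s_cont)
    also have "\<dots> \<le> (LINT x|sphere_prob. (g x - s x)\<^sup>2)"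
      by (intro integral_mono integrable_sphere_prob_continuous continuous_intros cont s_cont)
         (simp add: power2_diff)
    also have "\<dots> < \<epsilon>"
      using less by (simp add: s_def e_def)
    finally show ?thesis .
  qed
  then have "(LINT x|sphere_prob. (g x)\<^sup>2) \<le> 0"
    using not_le by blast
  moreover have "(LINT x|sphere_prob. (g x)\<^sup>2) \<ge> 0"
    by simp
  ultimately have "g x = 0"
    using integral_square_sphere_prob_eq_0 [OF cont(1) _ x] by linarith
  then show ?thesis
    by (simp add: g_def c_def mult.commute)
qed

section \<open>The Jacobi kernel as a spherical harmonic\<close>

lemma gchoose_ratio:
  fixes a :: "'a::field_char_0"
  shows "(a gchoose Suc k) * of_nat (Suc k) = (a gchoose k) * (a - of_nat k)"
  using gbinomial_mult_1 [of a k] by (simp add: algebra_simps)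

text \<open>
  Here \<open>Q\<close> is an orthogonal projection of rank \<open>q\<close>, and \<open>u\<close> and \<open>w\<close> are the squared lengths of the
  components of \<open>x\<close> in its range and in its kernel. Their gradients \<open>2 Q x\<close> and \<open>2 (x - Q x)\<close> are
  orthogonal and have squared lengths \<open>4 u\<close> and \<open>4 w\<close>, so no mixed term survives and each factor
  contributes the radial Laplacian of its own subspace. The left-hand side is the Laplacian, in a
  form that can be summed term by term.
\<close>

lemma laplacian_projection_power:
  fixes Q :: "'a::euclidean_space \<Rightarrow> 'a" and s i :: nat
  assumes lin: "linear Q" and idem: "\<And>x. Q (Q x) = Q x" and adj: "\<And>x y. Q x \<bullet> y = x \<bullet> Q y"
    and trace: "(\<Sum>b\<in>Basis. Q b \<bullet> b) = q"
  defines "u \<equiv> (\<lambda>x. x \<bullet> Q x)" and "w \<equiv> (\<lambda>x. x \<bullet> x - x \<bullet> Q x)"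
  shows "(\<Sum>b\<in>Basis. deriv_along b (deriv_along b (\<lambda>x. w x ^ s * u x ^ i)) x) =
    2 * real s * (2 * real s - 2 + real DIM('a) - q) * w x ^ (s - 1) * u x ^ i
      + 2 * real i * (2 * real i - 2 + q) * w x ^ s * u x ^ (i - 1)"
proof -
  have bl: "bounded_linear Q" using lin by (simp add: linear_linear)
  have u: "real_polynomial_function u"
    unfolding u_def by (rule real_polynomial_function_quadratic_form [OF lin])
  have w: "real_polynomial_function w"
    unfolding w_def
    by (intro real_polynomial_function_diff real_polynomial_function_quadratic_form lin
        linear_id [unfolded id_def])
  have Du: "deriv_along b u x = 2 * (x \<bullet> Q b)" for b x
  proof -
    have "(u has_derivative (\<lambda>h. x \<bullet> Q h + h \<bullet> Q x)) (at x)"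
      unfolding u_def by (intro has_derivative_inner bounded_linear.has_derivative [OF bl] has_derivative_ident)
    from deriv_along_eqI [OF this] show ?thesis
      using adj [of b x] by (simp add: inner_commute)
  qed
  have Dw: "deriv_along b w x = 2 * (x \<bullet> (b - Q b))" for b x
  proof -
    have "(w has_derivative (\<lambda>h. (x \<bullet> h + h \<bullet> x) - (x \<bullet> Q h + h \<bullet> Q x))) (at x)"
      unfolding w_def by (intro has_derivative_diff has_derivative_inner bounded_linear.has_derivative [OF bl] has_derivative_ident)
    from deriv_along_eqI [OF this] show ?thesis
      using adj [of b x] by (simp add: inner_commute inner_diff_right)
  qed
  have poly: "real_polynomial_function (\<lambda>x. c * w x ^ s * u x ^ i * (x \<bullet> d))" for c s i d
    by (intro real_polynomial_function.intros(2,4) real_polynomial_function_power u w real_polynomial_function_inner_left)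
  have D: "deriv_along b (\<lambda>x. w x ^ s * u x ^ i) x =
     2 * real s * w x ^ (s - 1) * u x ^ i * (x \<bullet> (b - Q b)) + 2 * real i * w x ^ s * u x ^ (i - 1) * (x \<bullet> Q b)" for b x s i
    by (simp add: deriv_along_mult deriv_along_power real_polynomial_function_power u w Du Dw algebra_simps)
  have Dc: "deriv_along b (\<lambda>x. c * w x ^ s * u x ^ i * (x \<bullet> d)) x =
     c * w x ^ s * u x ^ i * (b \<bullet> d) + c * (x \<bullet> d) * deriv_along b (\<lambda>x. w x ^ s * u x ^ i) x" for b x s i c d
  proof -
    have "deriv_along b (\<lambda>x. (w x ^ s * u x ^ i) * (c * (x \<bullet> d))) x =
      (w x ^ s * u x ^ i) * (c * (b \<bullet> d)) + deriv_along b (\<lambda>x. w x ^ s * u x ^ i) x * (c * (x \<bullet> d))"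
      by (subst deriv_along_mult)
         (auto simp: deriv_along_cmult real_polynomial_function_inner_left
            intro!: real_polynomial_function.intros(2,4) real_polynomial_function_power u w)
    then show ?thesis by (simp add: mult_ac)
  qed
  have parseval: "(\<Sum>b\<in>Basis. (x \<bullet> b) * (y \<bullet> b)) = x \<bullet> y" for x y :: 'a
    by (rule euclidean_inner [symmetric])
  have Qx: "x \<bullet> Q b = Q x \<bullet> b" "x \<bullet> (b - Q b) = (x - Q x) \<bullet> b" for b
    by (simp_all add: adj inner_diff_left inner_diff_right)
  have uu: "(\<Sum>b\<in>Basis. (x \<bullet> Q b) * (x \<bullet> Q b)) = u x"
    unfolding Qx parseval by (simp add: u_def adj idem)
  have ww: "(\<Sum>b\<in>Basis. (x \<bullet> (b - Q b)) * (x \<bullet> (b - Q b))) = w x"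
    unfolding Qx parseval by (simp add: w_def inner_diff_left inner_diff_right adj idem)
  have uw: "(\<Sum>b\<in>Basis. (x \<bullet> (b - Q b)) * (x \<bullet> Q b)) = 0"
    unfolding Qx parseval by (simp add: inner_diff_left adj idem)
  have tru: "(\<Sum>b\<in>Basis. b \<bullet> Q b) = q"
    using trace by (simp add: adj)
  have trw: "(\<Sum>b\<in>Basis. b \<bullet> (b - Q b)) = real DIM('a) - q"
    by (simp add: inner_diff_right sum_subtractf tru)
  have DD: "deriv_along b (deriv_along b (\<lambda>x. w x ^ s * u x ^ i)) x =
      2 * real s * w x ^ (s - 1) * u x ^ i * (b \<bullet> (b - Q b))
      + 2 * real s * (2 * real (s - 1) * w x ^ (s - 1 - 1) * u x ^ i) * ((x \<bullet> (b - Q b)) * (x \<bullet> (b - Q b)))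
      + 2 * (2 * real s * (2 * real i * w x ^ (s - 1) * u x ^ (i - 1))) * ((x \<bullet> (b - Q b)) * (x \<bullet> Q b))
      + 2 * real i * w x ^ s * u x ^ (i - 1) * (b \<bullet> Q b)
      + 2 * real i * (2 * real (i - 1) * w x ^ s * u x ^ (i - 1 - 1)) * ((x \<bullet> Q b) * (x \<bullet> Q b))" for b
  proof -
    have "deriv_along b (deriv_along b (\<lambda>x. w x ^ s * u x ^ i)) x =
      deriv_along b (\<lambda>x. 2 * real s * w x ^ (s - 1) * u x ^ i * (x \<bullet> (b - Q b))) x +
      deriv_along b (\<lambda>x. 2 * real i * w x ^ s * u x ^ (i - 1) * (x \<bullet> Q b)) x"
      unfolding D [abs_def] by (rule deriv_along_add [OF poly poly])
    then show ?thesis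
      unfolding Dc D by (simp only: distrib_left distrib_right mult_ac mult_2 mult_2_right add_ac)
  qed
  have "(\<Sum>b\<in>Basis. deriv_along b (deriv_along b (\<lambda>x. w x ^ s * u x ^ i)) x) =
      2 * real s * w x ^ (s - 1) * u x ^ i * (real DIM('a) - q)
      + 2 * real s * (2 * real (s - 1) * w x ^ (s - 1 - 1) * u x ^ i) * w x
      + 2 * real i * w x ^ s * u x ^ (i - 1) * q
      + 2 * real i * (2 * real (i - 1) * w x ^ s * u x ^ (i - 1 - 1)) * u x"
    unfolding DD sum.distrib sum_distrib_left [symmetric] uu ww uw tru trw by simp
  \<comment> \<open>Holds for \<open>k = 0\<close> and \<open>k = 1\<close> too, where the exponents are truncated but the factors vanish.\<close>
  moreover have pw: "real k * (real (k - 1) * (t ^ (k - 1 - 1) * t)) = real k * ((real k - 1) * t ^ (k - 1))"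
    for k :: nat and t :: real
    by (cases k; cases "k - 1") auto
  have "2 * real s * (2 * real (s - 1) * w x ^ (s - 1 - 1) * u x ^ i) * w x =
      4 * u x ^ i * (real s * (real (s - 1) * (w x ^ (s - 1 - 1) * w x)))"
    by (simp add: mult_ac)
  moreover have "2 * real i * (2 * real (i - 1) * w x ^ s * u x ^ (i - 1 - 1)) * u x =
      4 * w x ^ s * (real i * (real (i - 1) * (u x ^ (i - 1 - 1) * u x)))"
    by (simp add: mult_ac)
  ultimately show ?thesis
    unfolding pw by (simp add: algebra_simps)
qed

text \<open>
  On the sphere \<open>(t + 1) / 2 = u\<close> and \<open>(t - 1) / 2 = - w\<close> for \<open>t = 2 u - 1\<close>, because \<open>u + w = 1\<close>
  there. So the explicit form of the Jacobi polynomial extends from the sphere to the polynomial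
  \<open>p\<close>, homogeneous of degree \<open>m\<close> in \<open>u\<close> and \<open>w\<close>. With \<open>2 b + 2\<close> and \<open>2 a + 2\<close> the dimensions of
  the range and the kernel of \<open>Q\<close>, the coefficient of \<open>w\<^sup>s u\<^bsup>m - 1 - s\<^esup>\<close> in the Laplacian of \<open>p\<close>
  involves two consecutive coefficients of \<open>p\<close>, and they cancel.
\<close>

lemma spherical_harmonic_jacobi:
  fixes Q :: "'a::euclidean_space \<Rightarrow> 'a" and a b :: real and m :: nat
  assumes lin: "linear Q" and idem: "\<And>x. Q (Q x) = Q x" and adj: "\<And>x y. Q x \<bullet> y = x \<bullet> Q y"
    and trace: "(\<Sum>e\<in>Basis. Q e \<bullet> e) = 2 * b + 2" and dim: "real DIM('a) = 2 * a + 2 * b + 4"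
  shows "spherical_harmonic (2 * m) (\<lambda>x. jacobi_normalized a b m (2 * (x \<bullet> Q x) - 1))"
proof -
  define u where "u x = x \<bullet> Q x" for x
  define w where "w x = x \<bullet> x - x \<bullet> Q x" for x
  define c where "c s = ((real m + a) gchoose (m - s)) * ((real m + b) gchoose s) * (- 1) ^ s / jacobi_poly a b m 1" for s
  define p where "p x = (\<Sum>s\<le>m. c s * (w x ^ s * u x ^ (m - s)))" for x
  have polyu: "real_polynomial_function u"
    unfolding u_def by (rule real_polynomial_function_quadratic_form [OF lin])
  have polyw: "real_polynomial_function w"
    unfolding w_def
    by (intro real_polynomial_function_diff real_polynomial_function_quadratic_form lin
        linear_id [unfolded id_def])
  have polys: "real_polynomial_function (\<lambda>x. w x ^ s * u x ^ i)" for s i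
    by (intro real_polynomial_function.intros(4) real_polynomial_function_power polyu polyw)
  have polyp: "real_polynomial_function p"
    unfolding p_def by (intro real_polynomial_function_sum real_polynomial_function.intros(2) polys
        real_polynomial_function.intros(4)) auto
  have rec: "c (Suc s) * (real s + 1) * (real s + 1 + a) = - (c s * real (m - s) * (real (m - s) + b))"
    if "s < m" for s
  proof -
    have "Suc (m - Suc s) = m - s" using that by simp
    then have "((real m + a) gchoose (m - s)) * real (m - s) = ((real m + a) gchoose (m - Suc s)) * (real s + 1 + a)"
      using gchoose_ratio [of "real m + a" "m - Suc s"] that by (simp add: of_nat_diff algebra_simps)
    moreover have "((real m + b) gchoose Suc s) * (real s + 1) = ((real m + b) gchoose s) * (real (m - s) + b)"
      using gchoose_ratio [of "real m + b" s] that by (simp add: of_nat_diff algebra_simps)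
    ultimately have "((real m + a) gchoose (m - Suc s)) * (real s + 1 + a) * (((real m + b) gchoose Suc s) * (real s + 1)) =
       ((real m + a) gchoose (m - s)) * real (m - s) * (((real m + b) gchoose s) * (real (m - s) + b))"
      by simp
    moreover have "c (Suc s) * (real s + 1) * (real s + 1 + a) = ((real m + a) gchoose (m - Suc s)) * (real s + 1 + a) *
        (((real m + b) gchoose Suc s) * (real s + 1)) * (- ((- 1) ^ s) / jacobi_poly a b m 1)"
      by (simp add: c_def mult_ac)
    moreover have "- (c s * real (m - s) * (real (m - s) + b)) = ((real m + a) gchoose (m - s)) * real (m - s) *
        (((real m + b) gchoose s) * (real (m - s) + b)) * (- ((- 1) ^ s) / jacobi_poly a b m 1)"
      by (simp add: c_def mult_ac)
    ultimately show ?thesis by simp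
  qed
  have "laplacian p x = 0" for x
  proof -
    have D: "deriv_along e p x = (\<Sum>s\<le>m. c s * deriv_along e (\<lambda>x. w x ^ s * u x ^ (m - s)) x)" for e x
      unfolding p_def by (simp add: deriv_along_sum deriv_along_cmult polys real_polynomial_function.intros)
    have DD: "deriv_along e (deriv_along e p) x =
        (\<Sum>s\<le>m. c s * deriv_along e (deriv_along e (\<lambda>x. w x ^ s * u x ^ (m - s))) x)" for e x
      unfolding D [abs_def]
      by (simp add: deriv_along_sum deriv_along_cmult polys real_polynomial_function.intros real_polynomial_function_deriv_along)
    have "laplacian p x = (\<Sum>s\<le>m. c s * (\<Sum>e\<in>Basis. deriv_along e (deriv_along e (\<lambda>x. w x ^ s * u x ^ (m - s))) x))"
      unfolding laplacian_polynomial [OF polyp] DD by (subst sum.swap) (simp add: sum_distrib_left)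
    also have "\<dots> = (\<Sum>s\<le>m. c s * (4 * real s * (real s + a) * w x ^ (s - 1) * u x ^ (m - s)
         + 4 * real (m - s) * (real (m - s) + b) * w x ^ s * u x ^ (m - s - 1)))"
      unfolding u_def w_def laplacian_projection_power [OF lin idem adj trace] dim
      by (intro sum.cong refl) (simp add: algebra_simps)
    also have "\<dots> = (\<Sum>s\<le>m. 4 * (c s * real s * (real s + a)) * w x ^ (s - 1) * u x ^ (m - s))
         + (\<Sum>s\<le>m. 4 * (c s * real (m - s) * (real (m - s) + b)) * w x ^ s * u x ^ (m - s - 1))"
      unfolding sum.distrib [symmetric] by (intro sum.cong refl) (simp add: algebra_simps)
    also have "\<dots> = 0"
    proof (cases m)
      case 0
      then show ?thesis by simp
    next
      case (Suc m')
      \<comment> \<open>Shift \<open>s\<close> by one: the term \<open>s = 0\<close> of the first sum and \<open>s = m\<close> of the second vanish.\<close>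
      have "(\<Sum>s\<le>m. 4 * (c s * real s * (real s + a)) * w x ^ (s - 1) * u x ^ (m - s)) =
          (\<Sum>s\<le>m'. 4 * (c (Suc s) * (real s + 1) * (real s + 1 + a)) * w x ^ s * u x ^ (m - s - 1))"
        unfolding Suc by (subst sum.atMost_Suc_shift) (simp add: add_ac)
      also have "\<dots> = - (\<Sum>s\<le>m'. 4 * (c s * real (m - s) * (real (m - s) + b)) * w x ^ s * u x ^ (m - s - 1))"
        unfolding sum_negf [symmetric] by (intro sum.cong refl) (simp only: rec Suc, simp add: rec Suc)
      also have "(\<Sum>s\<le>m'. 4 * (c s * real (m - s) * (real (m - s) + b)) * w x ^ s * u x ^ (m - s - 1)) =
          (\<Sum>s\<le>m. 4 * (c s * real (m - s) * (real (m - s) + b)) * w x ^ s * u x ^ (m - s - 1))"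
        by (simp add: Suc)
      finally show ?thesis by simp
    qed
    finally show ?thesis .
  qed
  moreover have "p (t *\<^sub>R x) = t ^ (2 * m) * p x" for t x
  proof -
    have *: "u (t *\<^sub>R x) = t\<^sup>2 * u x" "w (t *\<^sub>R x) = t\<^sup>2 * w x"
      by (simp_all add: u_def w_def linear_cmul [OF lin] power2_eq_square algebra_simps)
    show ?thesis
      unfolding p_def * sum_distrib_left
    proof (intro sum.cong refl)
      fix s assume "s \<in> {..m}"
      then have "t ^ (2 * m) = (t\<^sup>2) ^ s * (t\<^sup>2) ^ (m - s)"
        by (simp add: power_mult flip: power_add)
      then show "c s * ((t\<^sup>2 * w x) ^ s * (t\<^sup>2 * u x) ^ (m - s)) = t ^ (2 * m) * (c s * (w x ^ s * u x ^ (m - s)))"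
        by (simp add: power_mult_distrib mult_ac)
    qed
  qed
  moreover have "jacobi_normalized a b m (2 * (x \<bullet> Q x) - 1) = p x" if "x \<in> sphere 0 1" for x
  proof -
    have "x \<bullet> x = 1" using that by (simp add: norm_eq_1)
    then have *: "(2 * (x \<bullet> Q x) - 1 - 1) / 2 = - w x" "(2 * (x \<bullet> Q x) - 1 + 1) / 2 = u x"
      by (simp_all add: w_def u_def)
    show ?thesis
      unfolding jacobi_normalized_def jacobi_poly_def [of a b m "2 * (x \<bullet> Q x) - 1"] * p_def sum_divide_distrib
      by (intro sum.cong refl) (simp add: c_def power_minus [of "w x"] mult_ac)
  qed
  ultimately show ?thesis
    unfolding spherical_harmonic_def using polyp by blast
qed

text \<open>
  \<open>Q\<close> is multiplication by \<open>v v\<^sup>T\<close>, the orthogonal projection onto the span of the columns of \<open>v\<close>.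
\<close>

lemma stiefel_projection:
  fixes v :: "real ^ 'q ^ 'm"
  assumes v: "v \<in> stiefel"
  defines "Q \<equiv> \<lambda>x. v *v (x v* v)"
  shows "linear Q" "Q (Q x) = Q x" "Q x \<bullet> y = x \<bullet> Q y" "x \<bullet> Q x = (norm (x v* v))\<^sup>2"
    "(\<Sum>e\<in>Basis. Q e \<bullet> e) = real CARD('q)"
proof -
  have vv: "transpose v ** v = mat 1" using v by (simp add: stiefel_def)
  have dot: "Q x \<bullet> y = (x v* v) \<bullet> (y v* v)" for x y
  proof -
    have "Q x \<bullet> y = y \<bullet> (v *v (x v* v))"
      by (simp add: Q_def inner_commute)
    also have "\<dots> = (y v* v) \<bullet> (x v* v)"
      by (simp only: dot_lmul_matrix)
    finally show ?thesis
      by (simp only: inner_commute)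
  qed
  show "linear Q"
    using linear_compose [OF matrix_vector_mul_linear [of "transpose v"] matrix_vector_mul_linear [of v]]
    by (simp add: Q_def o_def)
  show "Q (Q x) = Q x"
  proof -
    have "(v *v a) v* v = (transpose v ** v) *v a" for a
      by (simp only: matrix_vector_mul_assoc [symmetric] transpose_matrix_vector)
    then show ?thesis
      by (simp add: Q_def vv)
  qed
  show "Q x \<bullet> y = x \<bullet> Q y" using dot inner_commute by metis
  show "x \<bullet> Q x = (norm (x v* v))\<^sup>2"
    by (subst inner_commute) (simp add: dot power2_norm_eq_inner)
  have "(\<Sum>e\<in>Basis. Q e \<bullet> e) = (\<Sum>i\<in>UNIV. (axis i 1 v* v) \<bullet> (axis i 1 v* v))"
    by (subst Basis_vec_def) (simp add: dot sum.UNION_disjoint UNION_singleton_eq_range sum.reindex inj_on_def axis_eq_axis)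
  also have "\<dots> = (\<Sum>i\<in>UNIV. \<Sum>k\<in>UNIV. (v $ i $ k)\<^sup>2)"
    by (simp add: inner_vec_def vector_matrix_mult_def axis_def if_distrib if_distribR power2_eq_square cong: if_cong)
  also have "\<dots> = (\<Sum>k\<in>UNIV. (transpose v ** v) $ k $ k)"
    by (subst sum.swap) (simp add: matrix_matrix_mult_def transpose_def power2_eq_square)
  also have "\<dots> = real CARD('q)"
    by (simp add: vv mat_def)
  finally show "(\<Sum>e\<in>Basis. Q e \<bullet> e) = real CARD('q)" .
qed

lemma alpha_pos:
  assumes "n \<ge> 2" "1 \<le> k" "k \<le> n - 1"
  shows "alpha n k j > 0"
proof -
  have "real (harmonic_dim n j) > 0"
    unfolding harmonic_dim_eq [OF assms(1)] using assms
    by (intro mult_pos_pos divide_pos_pos Gamma_real_pos) auto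
  moreover have "real k < real n" using assms by linarith
  then have "kappa n k j > 0"
    unfolding kappa_def using assms
    by (intro real_sqrt_gt_zero divide_pos_pos mult_pos_pos Gamma_real_pos zero_less_power sphere_area_pos) auto
  ultimately show ?thesis
    by (simp add: alpha_def)
qed

section \<open>The addition formula\<close>

theorem lemma3p7:
  fixes n k j :: nat
    and Y :: "nat \<Rightarrow> nat \<Rightarrow> real ^ 'm \<Rightarrow> real"
    and x :: "real ^ 'm"
    and v :: "real ^ 'q ^ 'm"
  assumes "n \<ge> 2" and "1 \<le> k" and "k \<le> n - 1"
    and "CARD('m) = n + 1" and "CARD('q) = n - k"
    and "spherical_harmonic_basis n Y"
    and "even j"
    and "x \<in> sphere 0 1" and "v \<in> stiefel"
  shows "jacobi_normalized ((real k - 1) / 2) ((real n - real k) / 2 - 1) (j div 2)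
           (2 * (norm (x v* v))\<^sup>2 - 1) =
         inverse (alpha n k j) * (\<Sum>l = 1..harmonic_dim n j. Y j l x * harmonic_hat n k Y j l v)"
proof -
  let ?K = "\<lambda>x. jacobi_kernel n k j x v"
  note Q = stiefel_projection [OF assms(9)]
  have "real CARD('q) = real n - real k" using assms(3,5) by simp
  then have "spherical_harmonic (2 * (j div 2)) (\<lambda>x. jacobi_normalized ((real k - 1) / 2) ((real n - real k) / 2 - 1) (j div 2)
        (2 * (x \<bullet> (v *v (x v* v))) - 1))"
    using assms(4) by (intro spherical_harmonic_jacobi Q) (auto simp: Q(5) field_simps)
  then have "spherical_harmonic j ?K"
    using assms(7) by (simp add: Q(4) jacobi_kernel_def)
  then have "?K x = (\<Sum>l = 1..harmonic_dim n j. Y j l x * (LINT y|sphere_prob. Y j l y * ?K y))"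
    using assms by (intro spherical_harmonic_expansion) auto
  also have "\<dots> = inverse (alpha n k j) * (\<Sum>l = 1..harmonic_dim n j. Y j l x * harmonic_hat n k Y j l v)"
    using alpha_pos [OF assms(1-3), of j]
    by (simp add: harmonic_hat_def sum_distrib_left field_simps)
  finally show ?thesis by (simp add: jacobi_kernel_def)
qed

end
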